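(* Let $(\mathbf B,F,\mathbf C,I)$ be a compatible quadruple of integral residuated lattices, write $B^-=B\setminus(F\cup I)$, $C^-=C\setminus(F\cup I)$, and let $\top_B$ denote the top element of $B\setminus F$ and $\bot_C$ the bottom element of $C\setminus I$ (whenever these are used below, they exist by the compatibility conditions). Define $\mathbf B\oplus_P\mathbf C$ ($P=(F,I)$) on $B\cup C$ with operations extending those of $\mathbf B$ and $\mathbf C$ as follows: for $x,y$ both in $B$ or both in $C$, $x\cdot y$, $x\backslash y$, $x/y$ are computed in $\mathbf B$, resp. $\mathbf C$; $x\wedge y$ is computed in $\mathbf B$ or $\mathbf C$ except that for $x,y\in C^-$ with $x\wedge_{\mathbf C}y\in I$ we set $x\wedge y=\top_B$; $x\vee y$ is computed in $\mathbf C$ or $\mathbf B$ except that for $x,y\in B^-$ with $x\vee_{\mathbf B}y\in F$ we set $x\vee y=\bot_C$; and for $b\in B^-$, $c\in C^-$: $bc=cb=\sigma_F(b)$; $b\wedge c=c\wedge b=b$; $b\vee c=c\vee b=c$; $b\backslash c=c/b=1$; $c\backslash b=\gamma_F(b)$ if $c$ is not a left $I$-divisor and $c\backslash b=\ell_I(c)$ if it is; $b/c=\gamma_F(b)$ if $c$ is not a right $I$-divisor and $b/c=r_I(c)$ if it is. Then $\mathbf B\oplus_P\mathbf C$ is an integral residuated lattice and it is the gluing of $\mathbf B$ and $\mathbf C$ over $F$ and $I$.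
   Context: An IRL is a residuated lattice ($xy\le z\iff y\le x\backslash z\iff x\le z/y$) with $1$ as top. A congruence filter is a nonempty upset closed under products and conjugates ($yx/y$, $y\backslash xy$); $[x]_F$ is the class under $\theta_F=\{(x,y):x\backslash y,y\backslash x\in F\}$. $(\mathbf B,F)$ is a weak lower-compatible pair if $F$ is a congruence filter of $\mathbf B$ strictly above $B\setminus F$, each $[b]_F$ ($b\in B\setminus F$) has a minimum $\sigma_F(b)$, and $b\,\sigma_F[B\setminus F],\ \sigma_F[B\setminus F]\,b\subseteq\sigma_F[B\setminus F]$ for $b\in B\setminus F$; it is a lower-compatible pair if moreover each $[b]_F$ has a maximum $\gamma_F(b)$. $c\in C^-$ is a left (right) $I$-divisor if $cc'\in I$ ($c'c\in I$) for some $c'\in C^-$. $(\mathbf C,I)$ is an upper-compatible pair if $I$ is a lattice ideal of $\mathbf C$ strictly below $C\setminus I$ and for each left $I$-divisor $c$ and right $I$-divisor $d$ the maxima $\ell_I(c)=\max\{c\backslash i:i\in I\}$ and $r_I(d)=\max\{i/d:i\in I\}$ exist. $(\mathbf B,F,\mathbf C,I)$ is a compatible quadruple if $(\mathbf B,F)$ is weak lower-compatible, $(\mathbf C,I)$ is upper-compatible, $B\cap C=F\cup I$ is a subalgebra of both, $F$ is strictly above $C\setminus F$, $I$ strictly below $C\setminus I$, and: (1) if some element of $C\setminus F$ is not an $I$-divisor then $(\mathbf B,F)$ is lower-compatible; (2) if $c,d\in C\setminus I$ with $cd\in I$ then $(cd)x=x(cd)=\sigma_F(x)$ for all $x\in B^-$;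 (3) if some $x,y\in B\setminus F$ have $x\vee y\in F$, then $C\setminus I$ has a bottom element; (4) if some $x,y\in C\setminus I$ have $x\wedge y\in I$, then $B\setminus F$ has a top element. A gluing of $\mathbf B$ and $\mathbf C$ over $F$ and $I$ is an IRL $\mathbf D$ with universe $B\cup C$, $B\cap C=F\cup I$, $F$ a congruence filter, $I$ a lattice ideal, $i<b<c<f$ for $i\in I$, $b\in B^-$, $c\in C^-$, $f\in F$, $C$ a subalgebra except possibly for $\wedge$, and $B$ a subalgebra except possibly for $\vee$.
   Formalization: Compatible quadruples are also required to have I strictly below B∖I (without this B⊕C can fail to be a lattice), and the claim that B⊕C is a gluing is made when F is also a congruence filter of C, which is necessary; "the gluing" means every gluing has these operations. *)

theory Defs
  imports "HOL-Algebra.Group"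
begin

text \<open>
  The two algebras to be glued share part of their universes, so residuated lattices are
  carrier-based structures over one ambient type. In infix notation \<open>ldiv A x z\<close> is \<open>x\z\<close> and
  \<open>rdiv A z y\<close> is \<open>z/y\<close>.
\<close>

record 'a res_lattice = "'a monoid" +
  rmeet :: "'a \<Rightarrow> 'a \<Rightarrow> 'a" (infixl "\<curlywedge>\<index>" 70)
  rjoin :: "'a \<Rightarrow> 'a \<Rightarrow> 'a" (infixl "\<curlyvee>\<index>" 65)
  ldiv :: "'a \<Rightarrow> 'a \<Rightarrow> 'a"
  rdiv :: "'a \<Rightarrow> 'a \<Rightarrow> 'a"

definition rle :: "('a, 'm) res_lattice_scheme \<Rightarrow> 'a \<Rightarrow> 'a \<Rightarrow> bool" where
  "rle A x y \<longleftrightarrow> x \<curlywedge>\<^bsub>A\<^esub> y = x"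

definition rless :: "('a, 'm) res_lattice_scheme \<Rightarrow> 'a \<Rightarrow> 'a \<Rightarrow> bool" where
  "rless A x y \<longleftrightarrow> rle A x y \<and> x \<noteq> y"

locale irl = monoid A for A :: "('a, 'm) res_lattice_scheme" (structure) +
  assumes meet_closed: "\<lbrakk>x \<in> carrier A; y \<in> carrier A\<rbrakk> \<Longrightarrow> x \<curlywedge> y \<in> carrier A"
    and join_closed: "\<lbrakk>x \<in> carrier A; y \<in> carrier A\<rbrakk> \<Longrightarrow> x \<curlyvee> y \<in> carrier A"
    and ldiv_closed: "\<lbrakk>x \<in> carrier A; y \<in> carrier A\<rbrakk> \<Longrightarrow> ldiv A x y \<in> carrier A"
    and rdiv_closed: "\<lbrakk>x \<in> carrier A; y \<in> carrier A\<rbrakk> \<Longrightarrow> rdiv A x y \<in> carrier A"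
    and meet_comm: "\<lbrakk>x \<in> carrier A; y \<in> carrier A\<rbrakk> \<Longrightarrow> x \<curlywedge> y = y \<curlywedge> x"
    and join_comm: "\<lbrakk>x \<in> carrier A; y \<in> carrier A\<rbrakk> \<Longrightarrow> x \<curlyvee> y = y \<curlyvee> x"
    and meet_assoc: "\<lbrakk>x \<in> carrier A; y \<in> carrier A; z \<in> carrier A\<rbrakk>
      \<Longrightarrow> (x \<curlywedge> y) \<curlywedge> z = x \<curlywedge> (y \<curlywedge> z)"
    and join_assoc: "\<lbrakk>x \<in> carrier A; y \<in> carrier A; z \<in> carrier A\<rbrakk>
      \<Longrightarrow> (x \<curlyvee> y) \<curlyvee> z = x \<curlyvee> (y \<curlyvee> z)"
    and meet_join_absorb: "\<lbrakk>x \<in> carrier A; y \<in> carrier A\<rbrakk> \<Longrightarrow> x \<curlywedge> (x \<curlyvee> y) = x"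
    and join_meet_absorb: "\<lbrakk>x \<in> carrier A; y \<in> carrier A\<rbrakk> \<Longrightarrow> x \<curlyvee> (x \<curlywedge> y) = x"
    and ldiv_residual: "\<lbrakk>x \<in> carrier A; y \<in> carrier A; z \<in> carrier A\<rbrakk>
      \<Longrightarrow> rle A (x \<otimes> y) z \<longleftrightarrow> rle A y (ldiv A x z)"
    and rdiv_residual: "\<lbrakk>x \<in> carrier A; y \<in> carrier A; z \<in> carrier A\<rbrakk>
      \<Longrightarrow> rle A (x \<otimes> y) z \<longleftrightarrow> rle A x (rdiv A z y)"
    and one_top: "x \<in> carrier A \<Longrightarrow> rle A x \<one>"

definition is_min :: "'a res_lattice \<Rightarrow> 'a set \<Rightarrow> 'a \<Rightarrow> bool" where
  "is_min A S m \<longleftrightarrow> m \<in> S \<and> (\<forall>x\<in>S. rle A m x)"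

definition is_max :: "'a res_lattice \<Rightarrow> 'a set \<Rightarrow> 'a \<Rightarrow> bool" where
  "is_max A S m \<longleftrightarrow> m \<in> S \<and> (\<forall>x\<in>S. rle A x m)"

definition strictly_below :: "'a res_lattice \<Rightarrow> 'a set \<Rightarrow> 'a set \<Rightarrow> bool" where
  "strictly_below A S T \<longleftrightarrow> (\<forall>s\<in>S. \<forall>t\<in>T. rless A s t)"

definition congruence_filter :: "'a res_lattice \<Rightarrow> 'a set \<Rightarrow> bool" where
  "congruence_filter A F \<longleftrightarrow>
     F \<subseteq> carrier A \<and> F \<noteq> {} \<and>
     (\<forall>x\<in>F. \<forall>y\<in>carrier A. rle A x y \<longrightarrow> y \<in> F) \<and>
     (\<forall>x\<in>F. \<forall>y\<in>F. x \<otimes>\<^bsub>A\<^esub> y \<in> F) \<and>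
     (\<forall>x\<in>F. \<forall>y\<in>carrier A. rdiv A (y \<otimes>\<^bsub>A\<^esub> x) y \<in> F \<and> ldiv A y (x \<otimes>\<^bsub>A\<^esub> y) \<in> F)"

text \<open>The empty ideal is admitted, so that gluing over \<open>F\<close> alone is an instance.\<close>

definition lattice_ideal :: "'a res_lattice \<Rightarrow> 'a set \<Rightarrow> bool" where
  "lattice_ideal A I \<longleftrightarrow>
     I \<subseteq> carrier A \<and>
     (\<forall>x\<in>I. \<forall>y\<in>carrier A. rle A y x \<longrightarrow> y \<in> I) \<and>
     (\<forall>x\<in>I. \<forall>y\<in>I. x \<curlyvee>\<^bsub>A\<^esub> y \<in> I)"

definition subalgebra :: "'a res_lattice \<Rightarrow> 'a set \<Rightarrow> bool" where
  "subalgebra A S \<longleftrightarrow>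
     S \<subseteq> carrier A \<and> \<one>\<^bsub>A\<^esub> \<in> S \<and>
     (\<forall>x\<in>S. \<forall>y\<in>S. x \<otimes>\<^bsub>A\<^esub> y \<in> S \<and> x \<curlywedge>\<^bsub>A\<^esub> y \<in> S \<and> x \<curlyvee>\<^bsub>A\<^esub> y \<in> S \<and>
        ldiv A x y \<in> S \<and> rdiv A x y \<in> S)"

definition agree_on :: "'a set \<Rightarrow> 'a res_lattice \<Rightarrow> 'a res_lattice \<Rightarrow> bool" where
  "agree_on S A A' \<longleftrightarrow>
     \<one>\<^bsub>A\<^esub> = \<one>\<^bsub>A'\<^esub> \<and>
     (\<forall>x\<in>S. \<forall>y\<in>S. x \<otimes>\<^bsub>A\<^esub> y = x \<otimes>\<^bsub>A'\<^esub> y \<and> x \<curlywedge>\<^bsub>A\<^esub> y = x \<curlywedge>\<^bsub>A'\<^esub> y \<and>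
        x \<curlyvee>\<^bsub>A\<^esub> y = x \<curlyvee>\<^bsub>A'\<^esub> y \<and>
        ldiv A x y = ldiv A' x y \<and> rdiv A x y = rdiv A' x y)"

definition filter_class :: "'a res_lattice \<Rightarrow> 'a set \<Rightarrow> 'a \<Rightarrow> 'a set" where
  "filter_class B F x = {y \<in> carrier B. ldiv B x y \<in> F \<and> ldiv B y x \<in> F}"

definition sigma :: "'a res_lattice \<Rightarrow> 'a set \<Rightarrow> 'a \<Rightarrow> 'a" where
  "sigma B F b = (THE m. is_min B (filter_class B F b) m)"

definition gamma :: "'a res_lattice \<Rightarrow> 'a set \<Rightarrow> 'a \<Rightarrow> 'a" where
  "gamma B F b = (THE m. is_max B (filter_class B F b) m)"

definition weak_lower_compatible :: "'a res_lattice \<Rightarrow> 'a set \<Rightarrow> bool" where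
  "weak_lower_compatible B F \<longleftrightarrow>
     congruence_filter B F \<and>
     strictly_below B (carrier B - F) F \<and>
     (\<forall>b\<in>carrier B - F. \<exists>m. is_min B (filter_class B F b) m) \<and>
     (\<forall>b\<in>carrier B - F. \<forall>s\<in>sigma B F ` (carrier B - F).
        b \<otimes>\<^bsub>B\<^esub> s \<in> sigma B F ` (carrier B - F) \<and>
        s \<otimes>\<^bsub>B\<^esub> b \<in> sigma B F ` (carrier B - F))"

definition lower_compatible :: "'a res_lattice \<Rightarrow> 'a set \<Rightarrow> bool" where
  "lower_compatible B F \<longleftrightarrow>
     weak_lower_compatible B F \<and>
     (\<forall>b\<in>carrier B - F. \<exists>m. is_max B (filter_class B F b) m)"

definition minus_part :: "'a res_lattice \<Rightarrow> 'a set \<Rightarrow> 'a set \<Rightarrow> 'a set" where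
  "minus_part A F I = carrier A - (F \<union> I)"

definition left_divisor :: "'a res_lattice \<Rightarrow> 'a set \<Rightarrow> 'a set \<Rightarrow> 'a \<Rightarrow> bool" where
  "left_divisor C F I c \<longleftrightarrow>
     c \<in> minus_part C F I \<and> (\<exists>c'\<in>minus_part C F I. c \<otimes>\<^bsub>C\<^esub> c' \<in> I)"

definition right_divisor :: "'a res_lattice \<Rightarrow> 'a set \<Rightarrow> 'a set \<Rightarrow> 'a \<Rightarrow> bool" where
  "right_divisor C F I c \<longleftrightarrow>
     c \<in> minus_part C F I \<and> (\<exists>c'\<in>minus_part C F I. c' \<otimes>\<^bsub>C\<^esub> c \<in> I)"

definition ell :: "'a res_lattice \<Rightarrow> 'a set \<Rightarrow> 'a \<Rightarrow> 'a" where
  "ell C I c = (THE m. is_max C ((\<lambda>i. ldiv C c i) ` I) m)"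

definition arr :: "'a res_lattice \<Rightarrow> 'a set \<Rightarrow> 'a \<Rightarrow> 'a" where
  "arr C I d = (THE m. is_max C ((\<lambda>i. rdiv C i d) ` I) m)"

text \<open>\<open>F\<close> is a parameter because the divisors range over \<open>C - (F \<union> I)\<close>.\<close>

definition upper_compatible :: "'a res_lattice \<Rightarrow> 'a set \<Rightarrow> 'a set \<Rightarrow> bool" where
  "upper_compatible C F I \<longleftrightarrow>
     lattice_ideal C I \<and>
     strictly_below C I (carrier C - I) \<and>
     (\<forall>c. left_divisor C F I c \<longrightarrow> (\<exists>m. is_max C ((\<lambda>i. ldiv C c i) ` I) m)) \<and>
     (\<forall>d. right_divisor C F I d \<longrightarrow> (\<exists>m. is_max C ((\<lambda>i. rdiv C i d) ` I) m))"

text \<open>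
  An \<open>I\<close>-divisor is a left or right \<open>I\<close>-divisor; the notion concerns elements of
  \<open>C - (F \<union> I)\<close> only, so the clause on non-divisors ranges over that set.
\<close>

definition compatible_quadruple ::
    "'a res_lattice \<Rightarrow> 'a set \<Rightarrow> 'a res_lattice \<Rightarrow> 'a set \<Rightarrow> bool" where
  "compatible_quadruple B F C I \<longleftrightarrow>
     irl B \<and> irl C \<and>
     weak_lower_compatible B F \<and> upper_compatible C F I \<and>
     carrier B \<inter> carrier C = F \<union> I \<and>
     subalgebra B (F \<union> I) \<and> subalgebra C (F \<union> I) \<and> agree_on (F \<union> I) B C \<and>
     strictly_below C (carrier C - F) F \<and>
     strictly_below B I (carrier B - I) \<and>
     ((\<exists>c\<in>minus_part C F I. \<not> (left_divisor C F I c \<or> right_divisor C F I c))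
        \<longrightarrow> lower_compatible B F) \<and>
     (\<forall>c\<in>carrier C - I. \<forall>d\<in>carrier C - I. c \<otimes>\<^bsub>C\<^esub> d \<in> I \<longrightarrow>
        (\<forall>x\<in>minus_part B F I.
           (c \<otimes>\<^bsub>C\<^esub> d) \<otimes>\<^bsub>B\<^esub> x = sigma B F x \<and> x \<otimes>\<^bsub>B\<^esub> (c \<otimes>\<^bsub>C\<^esub> d) = sigma B F x)) \<and>
     ((\<exists>x\<in>carrier B - F. \<exists>y\<in>carrier B - F. x \<curlyvee>\<^bsub>B\<^esub> y \<in> F)
        \<longrightarrow> (\<exists>m. is_min C (carrier C - I) m)) \<and>
     ((\<exists>x\<in>carrier C - I. \<exists>y\<in>carrier C - I. x \<curlywedge>\<^bsub>C\<^esub> y \<in> I)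
        \<longrightarrow> (\<exists>m. is_max B (carrier B - F) m))"

definition top_below :: "'a res_lattice \<Rightarrow> 'a set \<Rightarrow> 'a" where
  "top_below B F = (THE m. is_max B (carrier B - F) m)"

definition bot_above :: "'a res_lattice \<Rightarrow> 'a set \<Rightarrow> 'a" where
  "bot_above C I = (THE m. is_min C (carrier C - I) m)"

text \<open>
  In each operation the branches after the first two are reached, for arguments in the
  carrier, exactly when one argument lies in \<open>B - (F \<union> I)\<close> and the other in \<open>C - (F \<union> I)\<close>.
\<close>

definition glue ::
    "'a res_lattice \<Rightarrow> 'a set \<Rightarrow> 'a res_lattice \<Rightarrow> 'a set \<Rightarrow> 'a res_lattice" where
  "glue B F C I = \<lparr>
     carrier = carrier B \<union> carrier C,
     monoid.mult = (\<lambda>x y.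
       if x \<in> carrier B \<and> y \<in> carrier B then x \<otimes>\<^bsub>B\<^esub> y
       else if x \<in> carrier C \<and> y \<in> carrier C then x \<otimes>\<^bsub>C\<^esub> y
       else if x \<in> minus_part B F I then sigma B F x else sigma B F y),
     one = \<one>\<^bsub>B\<^esub>,
     rmeet = (\<lambda>x y.
       if x \<in> carrier B \<and> y \<in> carrier B then x \<curlywedge>\<^bsub>B\<^esub> y
       else if x \<in> carrier C \<and> y \<in> carrier C then
         (if x \<in> minus_part C F I \<and> y \<in> minus_part C F I \<and> x \<curlywedge>\<^bsub>C\<^esub> y \<in> I
          then top_below B F else x \<curlywedge>\<^bsub>C\<^esub> y)
       else if x \<in> minus_part B F I then x else y),
     rjoin = (\<lambda>x y.
       if x \<in> carrier C \<and> y \<in> carrier C then x \<curlyvee>\<^bsub>C\<^esub> y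
       else if x \<in> carrier B \<and> y \<in> carrier B then
         (if x \<in> minus_part B F I \<and> y \<in> minus_part B F I \<and> x \<curlyvee>\<^bsub>B\<^esub> y \<in> F
          then bot_above C I else x \<curlyvee>\<^bsub>B\<^esub> y)
       else if x \<in> minus_part B F I then y else x),
     ldiv = (\<lambda>x y.
       if x \<in> carrier B \<and> y \<in> carrier B then ldiv B x y
       else if x \<in> carrier C \<and> y \<in> carrier C then ldiv C x y
       else if x \<in> minus_part B F I then \<one>\<^bsub>B\<^esub>
       else if left_divisor C F I x then ell C I x else gamma B F y),
     rdiv = (\<lambda>x y.
       if x \<in> carrier B \<and> y \<in> carrier B then rdiv B x y
       else if x \<in> carrier C \<and> y \<in> carrier C then rdiv C x y
       else if y \<in> minus_part B F I then \<one>\<^bsub>B\<^esub>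
       else if right_divisor C F I y then arr C I y else gamma B F x)\<rparr>"

text \<open>
  The chain \<open>i < b < c < f\<close> is stated for each pair of levels, so that it keeps its content when
  some level is empty. The pair \<open>i < f\<close> follows by transitivity as soon as one of the two
  middle levels is inhabited; otherwise the chain imposes no condition.
\<close>

definition is_gluing ::
    "'a res_lattice \<Rightarrow> 'a set \<Rightarrow> 'a res_lattice \<Rightarrow> 'a set \<Rightarrow> 'a res_lattice \<Rightarrow> bool" where
  "is_gluing B F C I D \<longleftrightarrow>
     irl D \<and>
     carrier D = carrier B \<union> carrier C \<and>
     carrier B \<inter> carrier C = F \<union> I \<and>
     congruence_filter D F \<and> lattice_ideal D I \<and>
     strictly_below D I (minus_part B F I) \<and>
     strictly_below D I (minus_part C F I) \<and>
     strictly_below D (minus_part B F I) (minus_part C F I) \<and>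
     strictly_below D (minus_part B F I) F \<and>
     strictly_below D (minus_part C F I) F \<and>
     \<one>\<^bsub>D\<^esub> = \<one>\<^bsub>C\<^esub> \<and>
     (\<forall>x\<in>carrier C. \<forall>y\<in>carrier C.
        x \<otimes>\<^bsub>D\<^esub> y = x \<otimes>\<^bsub>C\<^esub> y \<and> x \<curlyvee>\<^bsub>D\<^esub> y = x \<curlyvee>\<^bsub>C\<^esub> y \<and>
        ldiv D x y = ldiv C x y \<and> rdiv D x y = rdiv C x y) \<and>
     \<one>\<^bsub>D\<^esub> = \<one>\<^bsub>B\<^esub> \<and>
     (\<forall>x\<in>carrier B. \<forall>y\<in>carrier B.
        x \<otimes>\<^bsub>D\<^esub> y = x \<otimes>\<^bsub>B\<^esub> y \<and> x \<curlywedge>\<^bsub>D\<^esub> y = x \<curlywedge>\<^bsub>B\<^esub> y \<and>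
        ldiv D x y = ldiv B x y \<and> rdiv D x y = rdiv B x y)"

end

theory Submission
  imports Defs
begin

text \<open>
  If \<open>B\<^sup>- = B - (F \<union> I)\<close> or \<open>C\<^sup>- = C - (F \<union> I)\<close> is empty, the glued algebra coincides with \<open>C\<close>,
  resp. \<open>B\<close>. Otherwise \<open>F\<close> and \<open>I\<close> are disjoint, and since \<open>F \<union> I\<close> is closed under division, a
  product with an element of \<open>F\<close> lies in \<open>I\<close> only if the other factor does. Hence
  \<open>\<sigma>\<close> preserves \<open>B\<^sup>-\<close>, and clause (2) of compatibility rules out \<open>I\<close>-divisors. Moreover
  \<open>ci = ic = \<sigma>(i)\<close> for \<open>c \<in> C\<^sup>-\<close> and \<open>i \<in> I\<close>, so \<open>I\<close> needs no separate treatment: the order is the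
  ordinal sum of \<open>B - F\<close>, \<open>C\<^sup>-\<close> and \<open>F\<close>, with \<open>xc = cx = \<sigma>(x)\<close> for all \<open>x \<in> B - F\<close>, \<open>c \<in> C\<^sup>-\<close>.
  For uniqueness, every gluing has this order, and \<open>c \<le> b\(bc)\<close> forces \<open>b\(bc) \<in> F\<close>, hence
  \<open>bc = \<sigma>(b)\<close>; order and product determine the remaining operations.
\<close>

section \<open>Integral residuated lattices\<close>

context irl
begin

lemma le_refl: "x \<in> carrier A \<Longrightarrow> rle A x x"
  unfolding rle_def by (metis meet_join_absorb join_meet_absorb meet_closed)

lemma le_antisym: "\<lbrakk>rle A x y; rle A y x; x \<in> carrier A; y \<in> carrier A\<rbrakk> \<Longrightarrow> x = y"
  unfolding rle_def by (metis meet_comm)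

lemma le_trans:
  "\<lbrakk>rle A x y; rle A y z; x \<in> carrier A; y \<in> carrier A; z \<in> carrier A\<rbrakk> \<Longrightarrow> rle A x z"
  unfolding rle_def by (metis meet_assoc)

lemma le_iff_join: "\<lbrakk>x \<in> carrier A; y \<in> carrier A\<rbrakk> \<Longrightarrow> rle A x y \<longleftrightarrow> x \<curlyvee> y = y"
  unfolding rle_def by (metis meet_join_absorb join_meet_absorb meet_comm join_comm)

lemma meet_le1: "\<lbrakk>x \<in> carrier A; y \<in> carrier A\<rbrakk> \<Longrightarrow> rle A (x \<curlywedge> y) x"
  unfolding rle_def by (metis meet_assoc meet_comm meet_closed le_refl rle_def)

lemma meet_le2: "\<lbrakk>x \<in> carrier A; y \<in> carrier A\<rbrakk> \<Longrightarrow> rle A (x \<curlywedge> y) y"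
  by (metis meet_le1 meet_comm)

lemma le_meet_iff:
  assumes "x \<in> carrier A" "y \<in> carrier A" "z \<in> carrier A"
  shows "rle A z (x \<curlywedge> y) \<longleftrightarrow> rle A z x \<and> rle A z y"
proof
  show "rle A z (x \<curlywedge> y) \<Longrightarrow> rle A z x \<and> rle A z y"
    using assms by (meson le_trans meet_le1 meet_le2 meet_closed)
  show "rle A z x \<and> rle A z y \<Longrightarrow> rle A z (x \<curlywedge> y)"
    using assms unfolding rle_def by (metis meet_assoc)
qed

lemma join_ge1: "\<lbrakk>x \<in> carrier A; y \<in> carrier A\<rbrakk> \<Longrightarrow> rle A x (x \<curlyvee> y)"
  unfolding rle_def by (rule meet_join_absorb)

lemma join_ge2: "\<lbrakk>x \<in> carrier A; y \<in> carrier A\<rbrakk> \<Longrightarrow> rle A y (x \<curlyvee> y)"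
  by (metis join_ge1 join_comm)

lemma join_le_iff:
  assumes "x \<in> carrier A" "y \<in> carrier A" "z \<in> carrier A"
  shows "rle A (x \<curlyvee> y) z \<longleftrightarrow> rle A x z \<and> rle A y z"
proof
  show "rle A (x \<curlyvee> y) z \<Longrightarrow> rle A x z \<and> rle A y z"
    using assms by (meson le_trans join_ge1 join_ge2 join_closed)
  show "rle A x z \<and> rle A y z \<Longrightarrow> rle A (x \<curlyvee> y) z"
    using assms by (metis join_assoc join_closed le_iff_join)
qed

lemma mult_ldiv_le: "\<lbrakk>x \<in> carrier A; z \<in> carrier A\<rbrakk> \<Longrightarrow> rle A (x \<otimes> ldiv A x z) z"
  by (simp add: ldiv_residual ldiv_closed le_refl)

lemma rdiv_mult_le: "\<lbrakk>x \<in> carrier A; z \<in> carrier A\<rbrakk> \<Longrightarrow> rle A (rdiv A z x \<otimes> x) z"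
  by (simp add: rdiv_residual rdiv_closed le_refl)

lemma mult_mono_right:
  assumes "rle A x y" "x \<in> carrier A" "y \<in> carrier A" "z \<in> carrier A"
  shows "rle A (z \<otimes> x) (z \<otimes> y)"
  using assms by (meson le_refl le_trans ldiv_closed ldiv_residual m_closed)

lemma mult_mono_left:
  assumes "rle A x y" "x \<in> carrier A" "y \<in> carrier A" "z \<in> carrier A"
  shows "rle A (x \<otimes> z) (y \<otimes> z)"
  using assms by (meson le_refl le_trans rdiv_closed rdiv_residual m_closed)

lemma mult_le1: "\<lbrakk>x \<in> carrier A; y \<in> carrier A\<rbrakk> \<Longrightarrow> rle A (x \<otimes> y) x"
  using mult_mono_right[of y \<one> x] by (simp add: one_top)

lemma mult_le2: "\<lbrakk>x \<in> carrier A; y \<in> carrier A\<rbrakk> \<Longrightarrow> rle A (x \<otimes> y) y"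
  using mult_mono_left[of x \<one> y] by (simp add: one_top)

lemma le_ldiv: "\<lbrakk>x \<in> carrier A; y \<in> carrier A\<rbrakk> \<Longrightarrow> rle A y (ldiv A x y)"
  by (metis ldiv_residual mult_le2)

lemma le_rdiv: "\<lbrakk>x \<in> carrier A; y \<in> carrier A\<rbrakk> \<Longrightarrow> rle A y (rdiv A y x)"
  by (metis rdiv_residual mult_le1)

lemma one_le_iff: "x \<in> carrier A \<Longrightarrow> rle A \<one> x \<longleftrightarrow> x = \<one>"
  by (metis le_antisym le_refl one_closed one_top)

lemma ldiv_eq_one_iff: "\<lbrakk>x \<in> carrier A; y \<in> carrier A\<rbrakk> \<Longrightarrow> ldiv A x y = \<one> \<longleftrightarrow> rle A x y"
  by (metis ldiv_residual one_le_iff ldiv_closed one_closed r_one)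

lemma rdiv_eq_one_iff: "\<lbrakk>x \<in> carrier A; y \<in> carrier A\<rbrakk> \<Longrightarrow> rdiv A y x = \<one> \<longleftrightarrow> rle A x y"
  by (metis rdiv_residual one_le_iff rdiv_closed one_closed l_one)

end

section \<open>Extremal elements, and residuated lattices presented by their order\<close>

lemma the_is_max:
  assumes "irl A" "is_max A S m" "S \<subseteq> carrier A"
  shows "(THE m. is_max A S m) = m"
  using assms by (intro the_equality) (auto simp: is_max_def intro!: irl.le_antisym)

lemma the_is_min:
  assumes "irl A" "is_min A S m" "S \<subseteq> carrier A"
  shows "(THE m. is_min A S m) = m"
  using assms by (intro the_equality) (auto simp: is_min_def intro!: irl.le_antisym)

text \<open>Elements with the same lower set, or the same upper set, coincide by antisymmetry, so
  the lattice identities follow from the bound properties alone. This lets the glued operations be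
  checked against an explicit order, whose relation to \<open>rmeet\<close> comes out as a
  consequence.\<close>

lemma irl_of_order:
  assumes "monoid A"
    and meet_cl: "\<And>x y. \<lbrakk>x \<in> carrier A; y \<in> carrier A\<rbrakk> \<Longrightarrow> x \<curlywedge>\<^bsub>A\<^esub> y \<in> carrier A"
    and join_cl: "\<And>x y. \<lbrakk>x \<in> carrier A; y \<in> carrier A\<rbrakk> \<Longrightarrow> x \<curlyvee>\<^bsub>A\<^esub> y \<in> carrier A"
    and ldiv_cl: "\<And>x y. \<lbrakk>x \<in> carrier A; y \<in> carrier A\<rbrakk> \<Longrightarrow> ldiv A x y \<in> carrier A"
    and rdiv_cl: "\<And>x y. \<lbrakk>x \<in> carrier A; y \<in> carrier A\<rbrakk> \<Longrightarrow> rdiv A x y \<in> carrier A"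
    and refl: "\<And>x. x \<in> carrier A \<Longrightarrow> leq x x"
    and antisym: "\<And>x y. \<lbrakk>leq x y; leq y x; x \<in> carrier A; y \<in> carrier A\<rbrakk> \<Longrightarrow> x = y"
    and trans: "\<And>x y z. \<lbrakk>leq x y; leq y z; x \<in> carrier A; y \<in> carrier A; z \<in> carrier A\<rbrakk> \<Longrightarrow> leq x z"
    and meet: "\<And>x y z. \<lbrakk>x \<in> carrier A; y \<in> carrier A; z \<in> carrier A\<rbrakk>
      \<Longrightarrow> leq z (x \<curlywedge>\<^bsub>A\<^esub> y) \<longleftrightarrow> leq z x \<and> leq z y"
    and join: "\<And>x y z. \<lbrakk>x \<in> carrier A; y \<in> carrier A; z \<in> carrier A\<rbrakk>
      \<Longrightarrow> leq (x \<curlyvee>\<^bsub>A\<^esub> y) z \<longleftrightarrow> leq x z \<and> leq y z"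
    and ldiv: "\<And>x y z. \<lbrakk>x \<in> carrier A; y \<in> carrier A; z \<in> carrier A\<rbrakk>
      \<Longrightarrow> leq (x \<otimes>\<^bsub>A\<^esub> y) z \<longleftrightarrow> leq y (ldiv A x z)"
    and rdiv: "\<And>x y z. \<lbrakk>x \<in> carrier A; y \<in> carrier A; z \<in> carrier A\<rbrakk>
      \<Longrightarrow> leq (x \<otimes>\<^bsub>A\<^esub> y) z \<longleftrightarrow> leq x (rdiv A z y)"
    and one: "\<And>x. x \<in> carrier A \<Longrightarrow> leq x \<one>\<^bsub>A\<^esub>"
  shows "irl A"
proof -
  interpret monoid A by fact
  have eq_by_lower: "x = y"
    if "x \<in> carrier A" "y \<in> carrier A" "\<And>z. z \<in> carrier A \<Longrightarrow> leq z x \<longleftrightarrow> leq z y" for x y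
    using that by (blast intro: antisym refl)
  have eq_by_upper: "x = y"
    if "x \<in> carrier A" "y \<in> carrier A" "\<And>z. z \<in> carrier A \<Longrightarrow> leq x z \<longleftrightarrow> leq y z" for x y
    using that by (blast intro: antisym refl)
  have rle: "rle A x y \<longleftrightarrow> leq x y" if "x \<in> carrier A" "y \<in> carrier A" for x y
  proof
    show "rle A x y \<Longrightarrow> leq x y" using that unfolding rle_def by (metis meet refl)
    show "leq x y \<Longrightarrow> rle A x y" unfolding rle_def
      using that by (intro eq_by_lower) (auto simp: meet meet_cl intro: trans)
  qed
  show ?thesis
  proof unfold_locales
    fix x y assume [simp]: "x \<in> carrier A" "y \<in> carrier A"
    show "x \<curlywedge>\<^bsub>A\<^esub> y = y \<curlywedge>\<^bsub>A\<^esub> x" by (rule eq_by_lower) (auto simp: meet meet_cl)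
    show "x \<curlyvee>\<^bsub>A\<^esub> y = y \<curlyvee>\<^bsub>A\<^esub> x" by (rule eq_by_upper) (auto simp: join join_cl)
    have "leq x (x \<curlyvee>\<^bsub>A\<^esub> y)" using join[of x y "x \<curlyvee>\<^bsub>A\<^esub> y"] by (simp add: join_cl refl)
    then show "x \<curlywedge>\<^bsub>A\<^esub> (x \<curlyvee>\<^bsub>A\<^esub> y) = x"
      using rle[of x "x \<curlyvee>\<^bsub>A\<^esub> y"] by (simp add: join_cl rle_def)
    have "leq (x \<curlywedge>\<^bsub>A\<^esub> y) x" using meet[of x y "x \<curlywedge>\<^bsub>A\<^esub> y"] by (simp add: meet_cl refl)
    then show "x \<curlyvee>\<^bsub>A\<^esub> (x \<curlywedge>\<^bsub>A\<^esub> y) = x"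
      by (intro eq_by_upper) (auto simp: join join_cl meet_cl intro: trans[of "x \<curlywedge>\<^bsub>A\<^esub> y" x])
    fix z assume [simp]: "z \<in> carrier A"
    show "(x \<curlywedge>\<^bsub>A\<^esub> y) \<curlywedge>\<^bsub>A\<^esub> z = x \<curlywedge>\<^bsub>A\<^esub> (y \<curlywedge>\<^bsub>A\<^esub> z)"
      by (rule eq_by_lower) (auto simp: meet meet_cl)
    show "(x \<curlyvee>\<^bsub>A\<^esub> y) \<curlyvee>\<^bsub>A\<^esub> z = x \<curlyvee>\<^bsub>A\<^esub> (y \<curlyvee>\<^bsub>A\<^esub> z)"
      by (rule eq_by_upper) (auto simp: join join_cl)
  qed (simp_all add: meet_cl join_cl ldiv_cl rdiv_cl rle one flip: ldiv rdiv)
qed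

text \<open>The axioms only see the operations on the carrier. This settles gluings with an empty
  middle level.\<close>

lemma irl_cong:
  assumes "irl A" "carrier A' = carrier A" "agree_on (carrier A) A' A"
  shows "irl A'"
proof -
  interpret irl A by fact
  have eqs: "x \<otimes>\<^bsub>A'\<^esub> y = x \<otimes>\<^bsub>A\<^esub> y" "x \<curlywedge>\<^bsub>A'\<^esub> y = x \<curlywedge>\<^bsub>A\<^esub> y" "x \<curlyvee>\<^bsub>A'\<^esub> y = x \<curlyvee>\<^bsub>A\<^esub> y"
    "ldiv A' x y = ldiv A x y" "rdiv A' x y = rdiv A x y"
    if "x \<in> carrier A" "y \<in> carrier A" for x y
    using assms(3) that by (auto simp: agree_on_def)
  have one: "\<one>\<^bsub>A'\<^esub> = \<one>\<^bsub>A\<^esub>" using assms(3) by (simp add: agree_on_def)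
  show ?thesis
    by (rule irl_of_order[where leq = "rle A"])
      (auto intro!: monoidI simp: assms(2) eqs one m_assoc meet_closed join_closed ldiv_closed
        rdiv_closed le_refl le_meet_iff join_le_iff one_top
        intro: le_antisym le_trans simp flip: ldiv_residual rdiv_residual)
qed

text \<open>Meets and divisions are fixed by the elements below them, joins by the elements above
  them, and residuation describes the lower sets of divisions by order and product. This turns
  agreement in order and product into uniqueness of a gluing.\<close>

lemma irl_agree_of_order_mult:
  fixes A A' :: "'a res_lattice"
  assumes "irl A" "irl A'" and carrier: "carrier A' = carrier A"
    and rle: "\<And>x y. \<lbrakk>x \<in> carrier A; y \<in> carrier A\<rbrakk> \<Longrightarrow> rle A' x y \<longleftrightarrow> rle A x y"
    and mult: "\<And>x y. \<lbrakk>x \<in> carrier A; y \<in> carrier A\<rbrakk> \<Longrightarrow> x \<otimes>\<^bsub>A'\<^esub> y = x \<otimes>\<^bsub>A\<^esub> y"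
  shows "agree_on (carrier A) A A'"
proof -
  interpret irl A by fact
  interpret A': irl A' by fact
  note cl = A'.meet_closed A'.join_closed A'.ldiv_closed A'.rdiv_closed
  note cl' = cl[unfolded carrier] A'.one_closed[unfolded carrier]
  have eq_by_lower: "x = y"
    if "x \<in> carrier A" "y \<in> carrier A" "\<And>z. z \<in> carrier A \<Longrightarrow> rle A z x \<longleftrightarrow> rle A z y" for x y
    using that by (blast intro: le_antisym le_refl)
  have eq_by_upper: "x = y"
    if "x \<in> carrier A" "y \<in> carrier A" "\<And>z. z \<in> carrier A \<Longrightarrow> rle A x z \<longleftrightarrow> rle A y z" for x y
    using that by (blast intro: le_antisym le_refl)
  show ?thesis unfolding agree_on_def
  proof (intro conjI ballI)
    show "\<one>\<^bsub>A\<^esub> = \<one>\<^bsub>A'\<^esub>"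
      using A'.one_top[of "\<one>\<^bsub>A\<^esub>"] by (simp add: carrier rle cl' one_le_iff)
    fix x y assume xy [simp]: "x \<in> carrier A" "y \<in> carrier A"
    show "x \<otimes>\<^bsub>A\<^esub> y = x \<otimes>\<^bsub>A'\<^esub> y" by (simp add: mult)
    show "x \<curlywedge>\<^bsub>A\<^esub> y = x \<curlywedge>\<^bsub>A'\<^esub> y"
      using A'.le_meet_iff[of x y]
      by (intro eq_by_lower) (simp_all add: cl' meet_closed le_meet_iff carrier rle)
    show "x \<curlyvee>\<^bsub>A\<^esub> y = x \<curlyvee>\<^bsub>A'\<^esub> y"
      using A'.join_le_iff[of x y]
      by (intro eq_by_upper) (simp_all add: cl' join_closed join_le_iff carrier rle)
    show "ldiv A x y = ldiv A' x y"
      using A'.ldiv_residual[of x _ y]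
      by (intro eq_by_lower) (simp_all add: cl' ldiv_closed carrier rle mult flip: ldiv_residual)
    show "rdiv A x y = rdiv A' x y"
      using A'.rdiv_residual[of _ y x]
      by (intro eq_by_lower) (simp_all add: cl' rdiv_closed carrier rle mult flip: rdiv_residual)
  qed
qed

section \<open>Congruence filters and lower-compatible pairs\<close>

locale irl_filter = irl A for A :: "'a res_lattice" (structure) +
  fixes F :: "'a set"
  assumes filter: "congruence_filter A F"
begin

lemma filter_subset: "F \<subseteq> carrier A"
  and filter_up: "\<lbrakk>x \<in> F; rle A x y; y \<in> carrier A\<rbrakk> \<Longrightarrow> y \<in> F"
  and filter_mult: "\<lbrakk>x \<in> F; y \<in> F\<rbrakk> \<Longrightarrow> x \<otimes> y \<in> F"
  and filter_rconj: "\<lbrakk>x \<in> F; y \<in> carrier A\<rbrakk> \<Longrightarrow> rdiv A (y \<otimes> x) y \<in> F"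
  and filter_lconj: "\<lbrakk>x \<in> F; y \<in> carrier A\<rbrakk> \<Longrightarrow> ldiv A y (x \<otimes> y) \<in> F"
  using filter by (auto simp: congruence_filter_def)

lemma filter_carrier: "x \<in> F \<Longrightarrow> x \<in> carrier A"
  using filter_subset by auto

lemma one_in_filter: "\<one> \<in> F"
  using filter filter_up[OF _ one_top] by (auto simp: congruence_filter_def)

lemma mult_in_filter_iff:
  "\<lbrakk>x \<in> carrier A; y \<in> carrier A\<rbrakk> \<Longrightarrow> x \<otimes> y \<in> F \<longleftrightarrow> x \<in> F \<and> y \<in> F"
  by (meson filter_mult filter_up mult_le1 mult_le2)

text \<open>The residual itself is a witness in one direction; in the other, f lies below the
  residual and \<open>F\<close> is an upset. Working with such multipliers f keeps the computations
  with classes short.\<close>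

lemma ldiv_in_filter_iff:
  assumes "x \<in> carrier A" "z \<in> carrier A"
  shows "ldiv A x z \<in> F \<longleftrightarrow> (\<exists>f\<in>F. rle A (x \<otimes> f) z)"
  using assms by (meson filter_carrier filter_up ldiv_closed ldiv_residual mult_ldiv_le)

lemma rdiv_in_filter_iff:
  assumes "x \<in> carrier A" "z \<in> carrier A"
  shows "rdiv A z x \<in> F \<longleftrightarrow> (\<exists>f\<in>F. rle A (f \<otimes> x) z)"
  using assms by (meson filter_carrier filter_up rdiv_closed rdiv_residual rdiv_mult_le)

text \<open>Conjugation moves a multiplier to the other side: if f x \<le> z, then the conjugate g
  of f by x lies in \<open>F\<close> and x g \<le> f x \<le> z. Hence left and right division define
  the same congruence.\<close>

lemma rdiv_in_filter_iff_ldiv: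
  assumes x: "x \<in> carrier A" and z: "z \<in> carrier A"
  shows "rdiv A z x \<in> F \<longleftrightarrow> ldiv A x z \<in> F"
proof
  assume "rdiv A z x \<in> F"
  then obtain f where f: "f \<in> F" "rle A (f \<otimes> x) z" using assms by (auto simp: rdiv_in_filter_iff)
  have "rle A (x \<otimes> ldiv A x (f \<otimes> x)) z"
    using f x z by (meson filter_carrier le_trans ldiv_closed m_closed mult_ldiv_le)
  then show "ldiv A x z \<in> F" using filter_lconj f x z by (auto simp: ldiv_in_filter_iff)
next
  assume "ldiv A x z \<in> F"
  then obtain f where f: "f \<in> F" "rle A (x \<otimes> f) z" using assms by (auto simp: ldiv_in_filter_iff)
  have "rle A (rdiv A (x \<otimes> f) x \<otimes> x) z"
    using f x z by (meson filter_carrier le_trans rdiv_closed m_closed rdiv_mult_le)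
  then show "rdiv A z x \<in> F" using filter_rconj f x z by (auto simp: rdiv_in_filter_iff)
qed

lemma ldiv_in_filter_of_le:
  "\<lbrakk>rle A x z; x \<in> carrier A; z \<in> carrier A\<rbrakk> \<Longrightarrow> ldiv A x z \<in> F"
  using one_in_filter ldiv_eq_one_iff by metis

text \<open>Multipliers compose: x f \<le> y and y g \<le> z give x (f g) \<le> z.\<close>

lemma ldiv_in_filter_trans:
  assumes "ldiv A x y \<in> F" "ldiv A y z \<in> F"
    and c: "x \<in> carrier A" "y \<in> carrier A" "z \<in> carrier A"
  shows "ldiv A x z \<in> F"
proof -
  obtain f g where fg: "f \<in> F" "g \<in> F" "rle A (x \<otimes> f) y" "rle A (y \<otimes> g) z"
    using assms by (auto simp: ldiv_in_filter_iff)
  note fgc = filter_carrier[OF fg(1)] filter_carrier[OF fg(2)]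
  have "rle A (x \<otimes> f \<otimes> g) (y \<otimes> g)" using fg fgc c by (intro mult_mono_left) auto
  then have "rle A (x \<otimes> (f \<otimes> g)) z"
    using fg fgc c le_trans[of "x \<otimes> f \<otimes> g" "y \<otimes> g" z] by (simp add: m_assoc)
  then show ?thesis using c fg filter_mult by (auto simp: ldiv_in_filter_iff)
qed

lemma ldiv_mult_left_in_filter:
  assumes "ldiv A x y \<in> F" and c: "x \<in> carrier A" "y \<in> carrier A" "z \<in> carrier A"
  shows "ldiv A (z \<otimes> x) (z \<otimes> y) \<in> F"
proof -
  obtain f where f: "f \<in> F" "rle A (x \<otimes> f) y" using assms by (auto simp: ldiv_in_filter_iff)
  then have "rle A (z \<otimes> x \<otimes> f) (z \<otimes> y)"
    using c mult_mono_right[of "x \<otimes> f" y z] by (simp add: m_assoc filter_carrier)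
  then show ?thesis using c f by (auto simp: ldiv_in_filter_iff)
qed

text \<open>A multiplier on the left survives multiplication on the right, so the two divisions are
  exchanged first.\<close>

lemma ldiv_mult_right_in_filter:
  assumes "ldiv A x y \<in> F" and c: "x \<in> carrier A" "y \<in> carrier A" "z \<in> carrier A"
  shows "ldiv A (x \<otimes> z) (y \<otimes> z) \<in> F"
proof -
  have "rdiv A y x \<in> F" using assms by (simp add: rdiv_in_filter_iff_ldiv)
  then obtain f where f: "f \<in> F" "rle A (f \<otimes> x) y" using c by (auto simp: rdiv_in_filter_iff)
  then have "rle A (f \<otimes> (x \<otimes> z)) (y \<otimes> z)"
    using c mult_mono_left[of "f \<otimes> x" y z] by (simp add: m_assoc filter_carrier)
  then have "rdiv A (y \<otimes> z) (x \<otimes> z) \<in> F" using c f by (auto simp: rdiv_in_filter_iff)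
  then show ?thesis using c by (simp add: rdiv_in_filter_iff_ldiv)
qed

section \<open>Classes of the congruence of a filter\<close>

lemma class_subset: "filter_class A F x \<subseteq> carrier A"
  by (auto simp: filter_class_def)

lemma class_self: "x \<in> carrier A \<Longrightarrow> x \<in> filter_class A F x"
  by (simp add: filter_class_def ldiv_in_filter_of_le le_refl)

lemma class_eq:
  assumes "y \<in> filter_class A F x" "x \<in> carrier A"
  shows "filter_class A F y = filter_class A F x"
  using assms ldiv_in_filter_trans unfolding filter_class_def by blast

lemma class_mult_left:
  "\<lbrakk>y \<in> filter_class A F x; x \<in> carrier A; z \<in> carrier A\<rbrakk>
    \<Longrightarrow> z \<otimes> y \<in> filter_class A F (z \<otimes> x)"
  by (simp add: filter_class_def ldiv_mult_left_in_filter)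

lemma class_mult_right:
  "\<lbrakk>y \<in> filter_class A F x; x \<in> carrier A; z \<in> carrier A\<rbrakk>
    \<Longrightarrow> y \<otimes> z \<in> filter_class A F (x \<otimes> z)"
  by (simp add: filter_class_def ldiv_mult_right_in_filter)

text \<open>One direction holds because f \<le> 1, the other because 1 f \<le> f. Together with
  compatibility with products, it shows that multiplying by an element of \<open>F\<close> stays in
  the class.\<close>

lemma filter_in_class_one: "f \<in> F \<Longrightarrow> f \<in> filter_class A F \<one>"
  using one_in_filter
  by (auto simp: filter_class_def filter_carrier ldiv_in_filter_of_le one_top ldiv_in_filter_iff
    intro!: bexI[of _ f] le_refl)

lemma mult_filter_in_class:
  "\<lbrakk>f \<in> F; x \<in> carrier A\<rbrakk> \<Longrightarrow> x \<otimes> f \<in> filter_class A F x"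
  using class_mult_left[OF filter_in_class_one, of f x] by simp

lemma filter_mult_in_class:
  "\<lbrakk>f \<in> F; x \<in> carrier A\<rbrakk> \<Longrightarrow> f \<otimes> x \<in> filter_class A F x"
  using class_mult_right[OF filter_in_class_one, of f x] by simp

text \<open>If y and its residual into x both lie in \<open>F\<close>, then so does their product,
  which is below x.\<close>

lemma class_notin_filter:
  assumes "y \<in> filter_class A F x" "x \<in> carrier A" "x \<notin> F"
  shows "y \<notin> F"
proof
  assume "y \<in> F"
  moreover have "y \<in> carrier A" "ldiv A y x \<in> F" using assms by (auto simp: filter_class_def)
  ultimately have "y \<otimes> ldiv A y x \<in> F" by (intro filter_mult)
  then show False
    using filter_up mult_ldiv_le[of y x] assms \<open>y \<in> carrier A\<close> by blast
qed

end

section \<open>Weak lower-compatible pairs: minima and maxima of the classes\<close>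

locale weak_lower_pair = irl A for A :: "'a res_lattice" (structure) +
  fixes F :: "'a set"
  assumes weak_lower: "weak_lower_compatible A F"
begin

sublocale irl_filter A F
  using weak_lower by unfold_locales (simp add: weak_lower_compatible_def)

lemma below_filter: "\<lbrakk>x \<in> carrier A; x \<notin> F; f \<in> F\<rbrakk> \<Longrightarrow> rle A x f"
  using weak_lower by (auto simp: weak_lower_compatible_def strictly_below_def rless_def)

context
  fixes x assumes x: "x \<in> carrier A" "x \<notin> F"
begin

lemma sigma_is_min: "is_min A (filter_class A F x) (sigma A F x)"
proof -
  obtain m where m: "is_min A (filter_class A F x) m"
    using weak_lower x unfolding weak_lower_compatible_def by blast
  then show ?thesis using the_is_min[OF irl_axioms m class_subset] by (simp add: sigma_def)
qed

lemma sigma_in_class: "sigma A F x \<in> filter_class A F x"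
  using sigma_is_min by (simp add: is_min_def)

lemma sigma_carrier: "sigma A F x \<in> carrier A"
  using sigma_in_class class_subset by blast

lemma sigma_notin_filter: "sigma A F x \<notin> F"
  using class_notin_filter sigma_in_class x by blast

lemma sigma_le_class: "y \<in> filter_class A F x \<Longrightarrow> rle A (sigma A F x) y"
  using sigma_is_min by (simp add: is_min_def)

lemma sigma_class_eq: "y \<in> filter_class A F x \<Longrightarrow> sigma A F y = sigma A F x"
  using class_eq x by (simp add: sigma_def)

lemma sigma_sigma: "sigma A F (sigma A F x) = sigma A F x"
  using sigma_class_eq sigma_in_class by blast

text \<open>This is the order of the quotient by \<open>F\<close>: a multiplier f with x f \<le> z
  gives a member x f of the class of x, and the minimum of the class lies below it.\<close>

lemma sigma_le_iff_ldiv: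
  assumes z: "z \<in> carrier A"
  shows "rle A (sigma A F x) z \<longleftrightarrow> ldiv A x z \<in> F"
proof
  assume "rle A (sigma A F x) z"
  then show "ldiv A x z \<in> F"
    using sigma_in_class sigma_carrier x z
    by (auto simp: filter_class_def intro: ldiv_in_filter_trans ldiv_in_filter_of_le)
next
  assume "ldiv A x z \<in> F"
  then obtain f where "f \<in> F" "rle A (x \<otimes> f) z" using x z by (auto simp: ldiv_in_filter_iff)
  then show "rle A (sigma A F x) z"
    using sigma_le_class[OF mult_filter_in_class] x z
    by (meson filter_carrier le_trans m_closed sigma_carrier)
qed

lemma sigma_le_iff_rdiv:
  "z \<in> carrier A \<Longrightarrow> rle A (sigma A F x) z \<longleftrightarrow> rdiv A z x \<in> F"
  using x by (simp add: rdiv_in_filter_iff_ldiv sigma_le_iff_ldiv)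

text \<open>Multiplying by an element of \<open>F\<close> stays in the class and, by integrality,
  can only decrease; the minimum therefore absorbs it.\<close>

lemma sigma_mult_filter:
  assumes "f \<in> F"
  shows "sigma A F (x \<otimes> f) = sigma A F x" "sigma A F (f \<otimes> x) = sigma A F x"
    "sigma A F x \<otimes> f = sigma A F x" "f \<otimes> sigma A F x = sigma A F x"
proof -
  show "sigma A F (x \<otimes> f) = sigma A F x" "sigma A F (f \<otimes> x) = sigma A F x"
    using assms x by (auto intro: sigma_class_eq mult_filter_in_class filter_mult_in_class)
  have f: "f \<in> carrier A" using assms by (rule filter_carrier)
  have "sigma A F x \<otimes> f \<in> filter_class A F x" "f \<otimes> sigma A F x \<in> filter_class A F x"
    using mult_filter_in_class[OF assms sigma_carrier] filter_mult_in_class[OF assms sigma_carrier]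
      class_eq[OF sigma_in_class] x by auto
  then show "sigma A F x \<otimes> f = sigma A F x" "f \<otimes> sigma A F x = sigma A F x"
    using f sigma_carrier
    by (auto intro!: le_antisym sigma_le_class mult_le1 mult_le2)
qed

end

text \<open>The closure condition on the image of \<open>sigma\<close> enters here: x times sigma(y)
  is congruent to x y and is itself a value of \<open>sigma\<close>, hence the minimum of its own
  class.\<close>

lemma sigma_mult:
  assumes "x \<in> carrier A" "x \<notin> F" "y \<in> carrier A" "y \<notin> F"
  shows "x \<otimes> sigma A F y = sigma A F (x \<otimes> y)" "sigma A F x \<otimes> y = sigma A F (x \<otimes> y)"
proof -
  have xy: "x \<otimes> y \<in> carrier A" "x \<otimes> y \<notin> F" using assms by (auto simp: mult_in_filter_iff)
  have *: "z = sigma A F (x \<otimes> y)"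
    if "z \<in> filter_class A F (x \<otimes> y)" "z \<in> sigma A F ` (carrier A - F)" for z
  proof -
    from that obtain w where w: "w \<in> carrier A" "w \<notin> F" "z = sigma A F w" by auto
    then have "sigma A F z = z" by (simp add: sigma_sigma)
    then show ?thesis using sigma_class_eq[OF xy that(1)] by simp
  qed
  have "x \<otimes> sigma A F y \<in> sigma A F ` (carrier A - F)"
    "sigma A F x \<otimes> y \<in> sigma A F ` (carrier A - F)"
    using weak_lower assms by (auto simp: weak_lower_compatible_def)
  then show "x \<otimes> sigma A F y = sigma A F (x \<otimes> y)" "sigma A F x \<otimes> y = sigma A F (x \<otimes> y)"
    using assms by (auto intro!: * class_mult_left class_mult_right sigma_in_class)
qed

text \<open>\<open>gamma\<close> is upper adjoint to \<open>sigma\<close> below the filter, which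
  later makes it the right value for a division by an element of \<open>C\<close>. For the hard
  direction, a multiplier f with f y \<le> z also carries the join of y and z below z, so this join
  stays in the class of z and below its maximum.\<close>

lemma gamma_residual:
  assumes "lower_compatible A F" and z: "z \<in> carrier A" "z \<notin> F"
  shows gamma_carrier: "gamma A F z \<in> carrier A" and gamma_notin_filter: "gamma A F z \<notin> F"
    and "\<lbrakk>y \<in> carrier A; y \<notin> F\<rbrakk> \<Longrightarrow> rle A y (gamma A F z) \<longleftrightarrow> rle A (sigma A F y) z"
proof -
  obtain m where m: "is_max A (filter_class A F z) m"
    using assms unfolding lower_compatible_def by blast
  then have "is_max A (filter_class A F z) (gamma A F z)"
    using the_is_max[OF irl_axioms m class_subset] by (simp add: gamma_def)
  then have in_class: "gamma A F z \<in> filter_class A F z"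
    and max: "\<And>y. y \<in> filter_class A F z \<Longrightarrow> rle A y (gamma A F z)"
    by (auto simp: is_max_def)
  show g: "gamma A F z \<in> carrier A" using in_class class_subset by blast
  show "gamma A F z \<notin> F" using in_class class_notin_filter z by blast
  assume y: "y \<in> carrier A" "y \<notin> F"
  show "rle A y (gamma A F z) \<longleftrightarrow> rle A (sigma A F y) z"
  proof
    assume "rle A y (gamma A F z)"
    then have "ldiv A y z \<in> F" using in_class y z g
      by (auto simp: filter_class_def intro: ldiv_in_filter_trans ldiv_in_filter_of_le)
    then show "rle A (sigma A F y) z" using y z by (simp add: sigma_le_iff_ldiv)
  next
    assume "rle A (sigma A F y) z"
    then have "rdiv A z y \<in> F" using y z by (simp add: sigma_le_iff_rdiv)
    then obtain f where f: "f \<in> F" "rle A (f \<otimes> y) z" using y z by (auto simp: rdiv_in_filter_iff)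
    then have fc: "f \<in> carrier A" by (simp add: filter_carrier)
    have "rle A y (ldiv A f z)" "rle A z (ldiv A f z)"
      using f fc y z by (auto simp: le_ldiv simp flip: ldiv_residual)
    then have "rle A (y \<curlyvee> z) (ldiv A f z)" using fc y z by (simp add: join_le_iff ldiv_closed)
    then have "rle A (f \<otimes> (y \<curlyvee> z)) z" using fc y z by (simp add: ldiv_residual join_closed)
    then have "rdiv A z (y \<curlyvee> z) \<in> F" using f y z by (auto simp: rdiv_in_filter_iff join_closed)
    then have "y \<curlyvee> z \<in> filter_class A F z"
      using y z by (simp add: filter_class_def rdiv_in_filter_iff_ldiv join_closed
        ldiv_in_filter_of_le join_ge2)
    then show "rle A y (gamma A F z)"
      using max y z g by (meson le_trans join_ge1 join_closed)
  qed
qed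

end

section \<open>Compatible quadruples\<close>

text \<open>Let g be the residual of f x by f. The subalgebra condition puts g in
  \<open>F \<union> I\<close>, and x \<le> g. If x were outside \<open>I\<close>, so would be g;
  then g and f g lie in \<open>F\<close>, and f g \<le> f x puts f x in \<open>F\<close>, against
  disjointness. The other side is symmetric.\<close>

lemma ideal_prime_to_filter:
  fixes A :: "'a res_lattice"
  assumes "irl A" and sub: "subalgebra A (F \<union> I)"
    and up: "\<forall>x\<in>F. \<forall>y\<in>carrier A. rle A x y \<longrightarrow> y \<in> F"
    and mult: "\<forall>x\<in>F. \<forall>y\<in>F. x \<otimes>\<^bsub>A\<^esub> y \<in> F"
    and down: "\<forall>x\<in>I. \<forall>y\<in>carrier A. rle A y x \<longrightarrow> y \<in> I"
    and disj: "F \<inter> I = {}" and f: "f \<in> F" and x: "x \<in> carrier A"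
  shows "f \<otimes>\<^bsub>A\<^esub> x \<in> I \<Longrightarrow> x \<in> I" and "x \<otimes>\<^bsub>A\<^esub> f \<in> I \<Longrightarrow> x \<in> I"
proof -
  interpret irl A by fact
  have FI: "F \<union> I \<subseteq> carrier A" using sub by (simp add: subalgebra_def)
  then have fc: "f \<in> carrier A" using f by auto
  show "x \<in> I" if i: "f \<otimes>\<^bsub>A\<^esub> x \<in> I"
  proof (rule ccontr)
    let ?g = "ldiv A f (f \<otimes>\<^bsub>A\<^esub> x)"
    assume "x \<notin> I"
    have "rle A x ?g" using fc x by (simp add: le_refl flip: ldiv_residual)
    moreover have "?g \<in> F \<union> I" using sub f i by (auto simp: subalgebra_def)
    ultimately have "?g \<in> F" using down \<open>x \<notin> I\<close> x by blast
    then have "f \<otimes>\<^bsub>A\<^esub> ?g \<in> F" using f mult by blast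
    then have "f \<otimes>\<^bsub>A\<^esub> x \<in> F" using up mult_ldiv_le[of f "f \<otimes>\<^bsub>A\<^esub> x"] fc x by simp
    then show False using i disj by blast
  qed
  show "x \<in> I" if i: "x \<otimes>\<^bsub>A\<^esub> f \<in> I"
  proof (rule ccontr)
    let ?g = "rdiv A (x \<otimes>\<^bsub>A\<^esub> f) f"
    assume "x \<notin> I"
    have "rle A x ?g" using fc x by (simp add: le_refl flip: rdiv_residual)
    moreover have "?g \<in> F \<union> I" using sub f i by (auto simp: subalgebra_def)
    ultimately have "?g \<in> F" using down \<open>x \<notin> I\<close> x by blast
    then have "?g \<otimes>\<^bsub>A\<^esub> f \<in> F" using f mult by blast
    then have "x \<otimes>\<^bsub>A\<^esub> f \<in> F" using up rdiv_mult_le[of f "x \<otimes>\<^bsub>A\<^esub> f"] fc x by simp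
    then show False using i disj by blast
  qed
qed

locale compatible =
  fixes B :: "'a res_lattice" and F :: "'a set" and C :: "'a res_lattice" and I :: "'a set"
  assumes quad: "compatible_quadruple B F C I"
begin

sublocale B: weak_lower_pair B F
  using quad unfolding compatible_quadruple_def weak_lower_pair_def weak_lower_pair_axioms_def
  by blast

sublocale C: irl C
  using quad unfolding compatible_quadruple_def by blast

abbreviation "Bm \<equiv> minus_part B F I"
abbreviation "Cm \<equiv> minus_part C F I"
abbreviation "D \<equiv> glue B F C I"

lemma inter: "carrier B \<inter> carrier C = F \<union> I"
  and sub_B: "subalgebra B (F \<union> I)"
  and sub_C: "subalgebra C (F \<union> I)"
  and agree: "agree_on (F \<union> I) B C"
  and ideal: "lattice_ideal C I"
  using quad unfolding compatible_quadruple_def upper_compatible_def by blast+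

lemma one_eq: "\<one>\<^bsub>B\<^esub> = \<one>\<^bsub>C\<^esub>"
  using agree by (simp add: agree_on_def)

lemma in_both_iff: "x \<in> carrier B \<and> x \<in> carrier C \<longleftrightarrow> x \<in> F \<or> x \<in> I"
  using inter by blast

text \<open>The hypotheses name the two carriers rather than \<open>F \<union> I\<close> because the
  branches of \<open>glue\<close> test membership in the carriers.\<close>

lemma agree_ops:
  assumes "x \<in> carrier B" "x \<in> carrier C" "y \<in> carrier B" "y \<in> carrier C"
  shows "x \<otimes>\<^bsub>B\<^esub> y = x \<otimes>\<^bsub>C\<^esub> y" "x \<curlywedge>\<^bsub>B\<^esub> y = x \<curlywedge>\<^bsub>C\<^esub> y" "x \<curlyvee>\<^bsub>B\<^esub> y = x \<curlyvee>\<^bsub>C\<^esub> y"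
    "ldiv B x y = ldiv C x y" "rdiv B x y = rdiv C x y" "rle B x y \<longleftrightarrow> rle C x y"
proof -
  have "x \<in> F \<union> I" "y \<in> F \<union> I" using assms in_both_iff by blast+
  with agree show "x \<otimes>\<^bsub>B\<^esub> y = x \<otimes>\<^bsub>C\<^esub> y" "x \<curlywedge>\<^bsub>B\<^esub> y = x \<curlywedge>\<^bsub>C\<^esub> y" "x \<curlyvee>\<^bsub>B\<^esub> y = x \<curlyvee>\<^bsub>C\<^esub> y"
    "ldiv B x y = ldiv C x y" "rdiv B x y = rdiv C x y"
    by (auto simp: agree_on_def)
  then show "rle B x y \<longleftrightarrow> rle C x y" by (simp add: rle_def)
qed

lemma filter_carrier: "x \<in> F \<Longrightarrow> x \<in> carrier B" "x \<in> F \<Longrightarrow> x \<in> carrier C"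
  and ideal_carrier: "x \<in> I \<Longrightarrow> x \<in> carrier B" "x \<in> I \<Longrightarrow> x \<in> carrier C"
  using inter by blast+

lemma ideal_below_B: "\<lbrakk>i \<in> I; x \<in> carrier B; x \<notin> I\<rbrakk> \<Longrightarrow> rless B i x"
  and ideal_below_C: "\<lbrakk>i \<in> I; x \<in> carrier C; x \<notin> I\<rbrakk> \<Longrightarrow> rless C i x"
  and filter_above_B: "\<lbrakk>f \<in> F; x \<in> carrier B; x \<notin> F\<rbrakk> \<Longrightarrow> rless B x f"
  and filter_above_C: "\<lbrakk>f \<in> F; x \<in> carrier C; x \<notin> F\<rbrakk> \<Longrightarrow> rless C x f"
  using quad
  by (simp_all add: compatible_quadruple_def upper_compatible_def weak_lower_compatible_def
    strictly_below_def)

lemma ideal_down_B: "\<lbrakk>i \<in> I; rle B x i; x \<in> carrier B\<rbrakk> \<Longrightarrow> x \<in> I"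
  using ideal_below_B B.le_antisym ideal_carrier unfolding rless_def by blast

lemma ideal_down_C: "\<lbrakk>i \<in> I; rle C x i; x \<in> carrier C\<rbrakk> \<Longrightarrow> x \<in> I"
  using ideal_below_C C.le_antisym ideal_carrier unfolding rless_def by blast

lemma filter_up_C: "\<lbrakk>f \<in> F; rle C f x; x \<in> carrier C\<rbrakk> \<Longrightarrow> x \<in> F"
  using filter_above_C C.le_antisym filter_carrier unfolding rless_def by blast

lemma filter_mult_C: "\<lbrakk>x \<in> F; y \<in> F\<rbrakk> \<Longrightarrow> x \<otimes>\<^bsub>C\<^esub> y \<in> F"
  using B.filter_mult[of x y] agree_ops(1)[of x y] filter_carrier by simp

lemma filter_mult_eq: "\<lbrakk>x \<in> F; y \<in> F\<rbrakk> \<Longrightarrow> x \<otimes>\<^bsub>B\<^esub> y = x \<otimes>\<^bsub>C\<^esub> y"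
  by (simp add: agree_ops(1) filter_carrier)

text \<open>A common element would lie both strictly below and strictly above each element of a
  middle level.\<close>

lemma filter_ideal_disjoint:
  assumes "Bm \<noteq> {} \<or> Cm \<noteq> {}"
  shows "F \<inter> I = {}"
proof (rule ccontr)
  assume "F \<inter> I \<noteq> {}"
  then obtain z where z: "z \<in> F" "z \<in> I" by blast
  from assms consider x where "x \<in> Bm" | x where "x \<in> Cm" by blast
  then show False
  proof cases
    case 1
    then show ?thesis
      using z ideal_below_B[of z x] filter_above_B[of z x] B.le_antisym[of x z] filter_carrier
      by (auto simp: minus_part_def rless_def)
  next
    case 2
    then show ?thesis
      using z ideal_below_C[of z x] filter_above_C[of z x] C.le_antisym[of x z] filter_carrier
      by (auto simp: minus_part_def rless_def)
  qed
qed

section \<open>The glued operations inside one algebra, and an empty middle level\<close>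

lemma glue_carrier [simp]: "carrier D = carrier B \<union> carrier C"
  and glue_one [simp]: "\<one>\<^bsub>D\<^esub> = \<one>\<^bsub>B\<^esub>"
  by (simp_all add: glue_def)

text \<open>Joins are absent because \<open>rjoin\<close> sends a join of two elements of
  \<open>Bm\<close> that falls into \<open>F\<close> to \<open>bot_above\<close>. Dually,
  \<open>glue_C\<close> omits meets.\<close>

lemma glue_B:
  assumes "x \<in> carrier B" "y \<in> carrier B"
  shows "x \<otimes>\<^bsub>D\<^esub> y = x \<otimes>\<^bsub>B\<^esub> y" "x \<curlywedge>\<^bsub>D\<^esub> y = x \<curlywedge>\<^bsub>B\<^esub> y" "ldiv D x y = ldiv B x y"
    "rdiv D x y = rdiv B x y" "rle D x y \<longleftrightarrow> rle B x y"
  using assms by (simp_all add: glue_def rle_def)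

lemma glue_C:
  assumes "x \<in> carrier C" "y \<in> carrier C"
  shows "x \<otimes>\<^bsub>D\<^esub> y = x \<otimes>\<^bsub>C\<^esub> y" "x \<curlyvee>\<^bsub>D\<^esub> y = x \<curlyvee>\<^bsub>C\<^esub> y" "ldiv D x y = ldiv C x y"
    "rdiv D x y = rdiv C x y"
  using assms agree_ops[of x y] by (simp_all add: glue_def)

text \<open>With \<open>Bm\<close> empty, \<open>carrier B - F\<close> is \<open>I\<close>, and its
  top m lies below x and y. So m is below their meet, which lies in \<open>I\<close> and is thus
  below m: the exceptional meet is the meet of \<open>C\<close>.\<close>

lemma top_below_eq_meet:
  assumes "Bm = {}" and xy: "x \<in> Cm" "y \<in> Cm" "x \<curlywedge>\<^bsub>C\<^esub> y \<in> I"
  shows "top_below B F = x \<curlywedge>\<^bsub>C\<^esub> y"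
proof -
  have B_minus: "carrier B - F = I"
    using assms filter_ideal_disjoint ideal_carrier by (auto simp: minus_part_def)
  have xy': "x \<in> carrier C" "y \<in> carrier C" "x \<notin> I" "y \<notin> I"
    using xy by (auto simp: minus_part_def)
  then obtain m where m: "is_max B (carrier B - F) m"
    using quad xy(3) unfolding compatible_quadruple_def by blast
  have mI: "m \<in> I" using m by (simp add: is_max_def B_minus)
  have "rle B (x \<curlywedge>\<^bsub>C\<^esub> y) m" using m xy(3) by (simp add: is_max_def B_minus)
  then have le: "rle C (x \<curlywedge>\<^bsub>C\<^esub> y) m" using agree_ops(6) xy(3) mI ideal_carrier by simp
  have "rle C m x" "rle C m y" using ideal_below_C[OF mI] xy' by (auto simp: rless_def)
  then have "m = x \<curlywedge>\<^bsub>C\<^esub> y"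
    using le xy' mI by (intro C.le_antisym) (simp_all add: C.le_meet_iff C.meet_closed ideal_carrier)
  then show ?thesis
    unfolding top_below_def using the_is_max[OF B.irl_axioms m] by blast
qed

text \<open>Dually, with \<open>Cm\<close> empty the bottom of \<open>carrier C - I\<close> is the
  least element of \<open>F\<close>. It lies above x and y and below their join, which is in
  \<open>F\<close>.\<close>

lemma bot_above_eq_join:
  assumes "Cm = {}" and xy: "x \<in> Bm" "y \<in> Bm" "x \<curlyvee>\<^bsub>B\<^esub> y \<in> F"
  shows "bot_above C I = x \<curlyvee>\<^bsub>B\<^esub> y"
proof -
  have C_minus: "carrier C - I = F"
    using assms filter_ideal_disjoint filter_carrier by (auto simp: minus_part_def)
  have xy': "x \<in> carrier B" "y \<in> carrier B" "x \<notin> F" "y \<notin> F"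
    using xy by (auto simp: minus_part_def)
  then obtain m where m: "is_min C (carrier C - I) m"
    using quad xy(3) unfolding compatible_quadruple_def by blast
  have mF: "m \<in> F" using m by (simp add: is_min_def C_minus)
  have "rle C m (x \<curlyvee>\<^bsub>B\<^esub> y)" using m xy(3) by (simp add: is_min_def C_minus)
  then have le: "rle B m (x \<curlyvee>\<^bsub>B\<^esub> y)" using agree_ops(6) xy(3) mF filter_carrier by simp
  have "rle B x m" "rle B y m" using filter_above_B[OF mF] xy' by (auto simp: rless_def)
  then have "m = x \<curlyvee>\<^bsub>B\<^esub> y"
    using le xy' mF by (intro B.le_antisym) (simp_all add: B.join_le_iff B.join_closed filter_carrier)
  then show ?thesis
    unfolding bot_above_def using the_is_min[OF C.irl_axioms m] by blast
qed

lemma irl_glue_of_Bm_empty: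
  assumes "Bm = {}"
  shows "irl D"
proof -
  have BC: "carrier B \<subseteq> carrier C"
    using assms filter_carrier ideal_carrier by (auto simp: minus_part_def)
  have "x \<curlywedge>\<^bsub>D\<^esub> y = x \<curlywedge>\<^bsub>C\<^esub> y" if "x \<in> carrier C" "y \<in> carrier C" for x y
    using that agree_ops(2)[of x y] top_below_eq_meet[OF assms] by (simp add: glue_def)
  then have "agree_on (carrier C) D C" by (simp add: agree_on_def glue_C one_eq)
  then show ?thesis using BC by (intro irl_cong[OF C.irl_axioms]) auto
qed

lemma irl_glue_of_Cm_empty:
  assumes "Cm = {}"
  shows "irl D"
proof -
  have CB: "carrier C \<subseteq> carrier B"
    using assms filter_carrier ideal_carrier by (auto simp: minus_part_def)
  have "x \<curlyvee>\<^bsub>D\<^esub> y = x \<curlyvee>\<^bsub>B\<^esub> y" if "x \<in> carrier B" "y \<in> carrier B" for x y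
    using that agree_ops(3)[of x y] bot_above_eq_join[OF assms] by (simp add: glue_def)
  then have "agree_on (carrier B) D B" by (simp add: agree_on_def glue_B)
  then show ?thesis using CB by (intro irl_cong[OF B.irl_axioms]) auto
qed

end

section \<open>Gluing with both middle levels inhabited\<close>

locale compatible_proper = compatible +
  assumes Bm_nonempty: "Bm \<noteq> {}" and Cm_nonempty: "Cm \<noteq> {}"
begin

abbreviation "N \<equiv> carrier B - F"

lemma disj: "F \<inter> I = {}"
  using filter_ideal_disjoint Bm_nonempty by blast

lemma N_iff: "x \<in> N \<longleftrightarrow> x \<in> I \<or> x \<in> Bm"
  using disj ideal_carrier by (auto simp: minus_part_def)

lemma C_iff: "x \<in> carrier C \<longleftrightarrow> x \<in> I \<or> x \<in> Cm \<or> x \<in> F"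
  using filter_carrier ideal_carrier by (auto simp: minus_part_def)

lemma D_cases:
  assumes "x \<in> carrier D"
  obtains "x \<in> N" | "x \<in> Cm" | "x \<in> F"
  using assms C_iff N_iff by auto

lemma Cm_C: "x \<in> Cm \<Longrightarrow> x \<in> carrier C"
  and Cm_notin: "x \<in> Cm \<Longrightarrow> x \<notin> carrier B" "x \<in> Cm \<Longrightarrow> x \<notin> F" "x \<in> Cm \<Longrightarrow> x \<notin> I"
  and Bm_B: "x \<in> Bm \<Longrightarrow> x \<in> carrier B"
  and Bm_notin: "x \<in> Bm \<Longrightarrow> x \<notin> carrier C" "x \<in> Bm \<Longrightarrow> x \<notin> F" "x \<in> Bm \<Longrightarrow> x \<notin> I"
  using inter by (auto simp: minus_part_def)

section \<open>Products across the levels, and the absence of divisors\<close>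

lemma ideal_prime_B:
  "\<lbrakk>x \<otimes>\<^bsub>B\<^esub> f \<in> I \<or> f \<otimes>\<^bsub>B\<^esub> x \<in> I; f \<in> F; x \<in> carrier B\<rbrakk> \<Longrightarrow> x \<in> I"
  using ideal_prime_to_filter[OF B.irl_axioms sub_B _ _ _ disj] B.filter_up B.filter_mult
    ideal_down_B by blast

lemma ideal_prime_C:
  "\<lbrakk>x \<otimes>\<^bsub>C\<^esub> f \<in> I \<or> f \<otimes>\<^bsub>C\<^esub> x \<in> I; f \<in> F; x \<in> carrier C\<rbrakk> \<Longrightarrow> x \<in> I"
  using ideal_prime_to_filter[OF C.irl_axioms sub_C _ _ _ disj] filter_up_C filter_mult_C
    ideal_down_C by blast

lemma Cm_mult_filter:
  assumes "c \<in> Cm" "f \<in> F"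
  shows "c \<otimes>\<^bsub>C\<^esub> f \<in> Cm" "f \<otimes>\<^bsub>C\<^esub> c \<in> Cm"
proof -
  note cf = Cm_C[OF assms(1)] filter_carrier(2)[OF assms(2)]
  have "c \<otimes>\<^bsub>C\<^esub> f \<notin> F" "f \<otimes>\<^bsub>C\<^esub> c \<notin> F"
    using filter_up_C C.mult_le1[OF cf] C.mult_le2[OF cf(2,1)] cf(1) Cm_notin(2)[OF assms(1)] by blast+
  moreover have "c \<otimes>\<^bsub>C\<^esub> f \<notin> I" "f \<otimes>\<^bsub>C\<^esub> c \<notin> I"
    using ideal_prime_C assms cf(1) Cm_notin(3)[OF assms(1)] by blast+
  ultimately show "c \<otimes>\<^bsub>C\<^esub> f \<in> Cm" "f \<otimes>\<^bsub>C\<^esub> c \<in> Cm" using cf by (auto simp: minus_part_def)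
qed

text \<open>Some f in \<open>F\<close> gives b f \<le> sigma(b). Since b is outside
  \<open>I\<close>, so is b f, and \<open>I\<close> is a downset.\<close>

lemma sigma_Bm:
  assumes b: "b \<in> Bm"
  shows "sigma B F b \<in> Bm"
proof -
  have bB: "b \<in> carrier B" "b \<notin> F" using b Bm_B Bm_notin by auto
  have s: "sigma B F b \<in> carrier B" "sigma B F b \<notin> F"
    using bB by (simp_all add: B.sigma_carrier B.sigma_notin_filter)
  have "ldiv B b (sigma B F b) \<in> F" using bB s by (simp add: B.le_refl flip: B.sigma_le_iff_ldiv)
  then obtain f where f: "f \<in> F" "rle B (b \<otimes>\<^bsub>B\<^esub> f) (sigma B F b)"
    using bB s by (auto simp: B.ldiv_in_filter_iff)
  have "b \<otimes>\<^bsub>B\<^esub> f \<notin> I"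
    using ideal_prime_B f(1) bB(1) Bm_notin(3)[OF b] by blast
  then have "sigma B F b \<notin> I" using ideal_down_B f bB filter_carrier by blast
  then show ?thesis using s by (simp add: minus_part_def)
qed

text \<open>If \<open>cd \<in> I\<close>, clause (2) forces \<open>\<sigma>(b) = (cd)b \<in> I\<close>, whereas \<open>\<sigma>\<close> preserves \<open>B - (F \<union> I)\<close>.
  So there are no \<open>I\<close>-divisors once both middle levels are inhabited.\<close>

lemma Cm_mult:
  assumes "c \<in> Cm" "d \<in> Cm"
  shows "c \<otimes>\<^bsub>C\<^esub> d \<in> Cm"
proof -
  note cd = Cm_C[OF assms(1)] Cm_C[OF assms(2)]
  obtain b where b: "b \<in> Bm" using Bm_nonempty by blast
  have "c \<otimes>\<^bsub>C\<^esub> d \<notin> I"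
  proof
    assume i: "c \<otimes>\<^bsub>C\<^esub> d \<in> I"
    then have "(c \<otimes>\<^bsub>C\<^esub> d) \<otimes>\<^bsub>B\<^esub> b = sigma B F b"
      using quad b cd Cm_notin(3) assms unfolding compatible_quadruple_def by blast
    moreover have "(c \<otimes>\<^bsub>C\<^esub> d) \<otimes>\<^bsub>B\<^esub> b \<in> I"
      using i b ideal_down_B[OF i] B.mult_le1 ideal_carrier Bm_B by blast
    ultimately show False using sigma_Bm[OF b] Bm_notin by auto
  qed
  moreover have "c \<otimes>\<^bsub>C\<^esub> d \<notin> F"
    using filter_up_C C.mult_le1[OF cd] cd Cm_notin(2)[OF assms(1)] by blast
  ultimately show ?thesis using cd by (auto simp: minus_part_def)
qed

lemma no_divisors: "\<not> left_divisor C F I c" "\<not> right_divisor C F I c"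
  using Cm_mult Cm_notin(3) by (auto simp: left_divisor_def right_divisor_def)

text \<open>\<open>Cm\<close> is inhabited and consists of non-divisors, which triggers clause (1)
  and provides \<open>gamma\<close>.\<close>

lemma lower: "lower_compatible B F"
  using quad Cm_nonempty no_divisors unfolding compatible_quadruple_def by blast

text \<open>The residual of i c by i lies in \<open>F \<union> I\<close> and above c, hence in
  \<open>F\<close>; this says that sigma(i) \<le> i c. Conversely, the residual of sigma(i) by i
  lies in \<open>F\<close>, so it is above c.\<close>

lemma ideal_mult_Cm:
  assumes i: "i \<in> I" and c: "c \<in> Cm"
  shows "i \<otimes>\<^bsub>C\<^esub> c = sigma B F i" "c \<otimes>\<^bsub>C\<^esub> i = sigma B F i"
proof -
  note iBC = ideal_carrier[OF i] and cC = Cm_C[OF c]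
  have iF: "i \<notin> F" using i disj by blast
  have s: "sigma B F i \<in> I"
    using ideal_down_B[OF i B.sigma_le_class[OF _ _ B.class_self]] iBC iF B.sigma_carrier by simp
  note sBC = ideal_carrier[OF s]
  have inF: "w \<in> F" if "w \<in> F \<union> I" "rle C c w" for w
    using that ideal_down_C cC Cm_notin(3)[OF c] by blast
  \<comment> \<open>The criterion for \<open>sigma\<close> in \<open>B\<close> is transported to
    \<open>C\<close>, since order and divisions agree on \<open>I\<close>.\<close>
  have le: "rle C (sigma B F i) j \<longleftrightarrow> ldiv C i j \<in> F" "rle C (sigma B F i) j \<longleftrightarrow> rdiv C j i \<in> F"
    if "j \<in> I" for j
    using B.sigma_le_iff_ldiv[OF iBC(1) iF ideal_carrier(1)[OF that]]
      B.sigma_le_iff_rdiv[OF iBC(1) iF ideal_carrier(1)[OF that]]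
      agree_ops[of i j] agree_ops[of j i] agree_ops[of _ j] sBC iBC ideal_carrier that by auto
  show "i \<otimes>\<^bsub>C\<^esub> c = sigma B F i"
  proof (rule C.le_antisym)
    have j: "i \<otimes>\<^bsub>C\<^esub> c \<in> I" using ideal_down_C[OF i] C.mult_le1 iBC cC by simp
    have "ldiv C i (i \<otimes>\<^bsub>C\<^esub> c) \<in> F"
    proof (rule inF)
      show "ldiv C i (i \<otimes>\<^bsub>C\<^esub> c) \<in> F \<union> I"
        using sub_C i j unfolding subalgebra_def by blast
      show "rle C c (ldiv C i (i \<otimes>\<^bsub>C\<^esub> c))"
        using iBC cC by (simp add: C.le_refl flip: C.ldiv_residual)
    qed
    then show "rle C (sigma B F i) (i \<otimes>\<^bsub>C\<^esub> c)" using le j by simp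
    have "ldiv C i (sigma B F i) \<in> F" using le(1)[OF s] sBC by (simp add: C.le_refl)
    then show "rle C (i \<otimes>\<^bsub>C\<^esub> c) (sigma B F i)"
      using filter_above_C c Cm_notin cC iBC sBC by (simp add: C.ldiv_residual rless_def)
  qed (use iBC cC sBC in simp_all)
  show "c \<otimes>\<^bsub>C\<^esub> i = sigma B F i"
  proof (rule C.le_antisym)
    have j: "c \<otimes>\<^bsub>C\<^esub> i \<in> I" using ideal_down_C[OF i] C.mult_le2 iBC cC by simp
    have "rdiv C (c \<otimes>\<^bsub>C\<^esub> i) i \<in> F"
    proof (rule inF)
      show "rdiv C (c \<otimes>\<^bsub>C\<^esub> i) i \<in> F \<union> I"
        using sub_C i j unfolding subalgebra_def by blast
      show "rle C c (rdiv C (c \<otimes>\<^bsub>C\<^esub> i) i)"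
        using iBC cC by (simp add: C.le_refl flip: C.rdiv_residual)
    qed
    then show "rle C (sigma B F i) (c \<otimes>\<^bsub>C\<^esub> i)" using le j by simp
    have "rdiv C (sigma B F i) i \<in> F" using le(2)[OF s] sBC by (simp add: C.le_refl)
    then show "rle C (c \<otimes>\<^bsub>C\<^esub> i) (sigma B F i)"
      using filter_above_C c Cm_notin cC iBC sBC by (simp add: C.rdiv_residual rless_def)
  qed (use iBC cC sBC in simp_all)
qed

lemma glue_mult_mixed:
  assumes "x \<in> N" "c \<in> Cm"
  shows "x \<otimes>\<^bsub>D\<^esub> c = sigma B F x" "c \<otimes>\<^bsub>D\<^esub> x = sigma B F x"
proof -
  have "x \<otimes>\<^bsub>D\<^esub> c = sigma B F x \<and> c \<otimes>\<^bsub>D\<^esub> x = sigma B F x"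
  proof (cases "x \<in> I")
    case True
    then show ?thesis using assms by (simp add: glue_C ideal_carrier Cm_C ideal_mult_Cm)
  next
    case False
    then have "x \<in> Bm" "x \<notin> carrier C" using assms N_iff Bm_notin by auto
    moreover have "c \<notin> carrier B" "c \<notin> Bm" using assms Cm_notin Bm_B by auto
    ultimately show ?thesis by (simp add: glue_def)
  qed
  then show "x \<otimes>\<^bsub>D\<^esub> c = sigma B F x" "c \<otimes>\<^bsub>D\<^esub> x = sigma B F x" by auto
qed

lemma sigma_N: "x \<in> N \<Longrightarrow> sigma B F x \<in> N"
  by (simp add: B.sigma_carrier B.sigma_notin_filter)

lemma N_mult:
  assumes "x \<in> N" "y \<in> carrier B"
  shows "x \<otimes>\<^bsub>B\<^esub> y \<in> N" "y \<otimes>\<^bsub>B\<^esub> x \<in> N"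
  using assms by (simp_all add: B.mult_in_filter_iff)

lemma monoid_glue: "monoid D"
proof (rule monoidI)
  show "\<one>\<^bsub>D\<^esub> \<in> carrier D" by simp
  fix x assume x: "x \<in> carrier D"
  have one_C: "\<one>\<^bsub>B\<^esub> \<otimes>\<^bsub>D\<^esub> x = x" "x \<otimes>\<^bsub>D\<^esub> \<one>\<^bsub>B\<^esub> = x" if "x \<in> carrier C"
    using that glue_C(1)[of "\<one>\<^bsub>C\<^esub>" x] glue_C(1)[of x "\<one>\<^bsub>C\<^esub>"] by (simp_all add: one_eq)
  show "\<one>\<^bsub>D\<^esub> \<otimes>\<^bsub>D\<^esub> x = x" "x \<otimes>\<^bsub>D\<^esub> \<one>\<^bsub>D\<^esub> = x"
    using x one_C by (auto simp: glue_B(1))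
  fix y assume y: "y \<in> carrier D"
  note mult = glue_B(1) glue_C(1) glue_mult_mixed filter_carrier Cm_C Cm_mult Cm_mult_filter
    sigma_N N_mult B.filter_mult filter_mult_C
  from x y show "x \<otimes>\<^bsub>D\<^esub> y \<in> carrier D"
    by (elim D_cases) (use mult in auto)
  fix z assume z: "z \<in> carrier D"
  \<comment> \<open>If factors from both \<open>N\<close> and \<open>Cm\<close> occur, each
    bracketing gives \<open>sigma\<close> of the product of the factors in \<open>N\<close>.
    Otherwise all factors lie in \<open>B\<close> or all lie in \<open>C\<close>, and it only
    remains to match products of filter elements, which \<open>B\<close> and \<open>C\<close>
    compute alike.\<close>
  from x y z show "(x \<otimes>\<^bsub>D\<^esub> y) \<otimes>\<^bsub>D\<^esub> z = x \<otimes>\<^bsub>D\<^esub> (y \<otimes>\<^bsub>D\<^esub> z)"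
    by (elim D_cases)
      (simp_all add: mult B.m_assoc C.m_assoc B.sigma_sigma B.sigma_mult B.sigma_mult_filter
        B.sigma_carrier B.sigma_notin_filter B.mult_in_filter_iff,
       simp_all add: filter_mult_eq C.m_assoc filter_carrier Cm_C)
qed

section \<open>The ordinal-sum order on the glued carrier\<close>

text \<open>Defined without \<open>rmeet\<close>, to serve as the order in
  \<open>irl_of_order\<close>. The last clause is written with \<open>N\<close> so that
  \<open>I\<close> is handled together with \<open>Bm\<close>, although \<open>C\<close> already
  compares \<open>I\<close> with \<open>Cm\<close>.\<close>

definition gle :: "'a \<Rightarrow> 'a \<Rightarrow> bool" where
  "gle x y \<longleftrightarrow> x \<in> carrier B \<and> y \<in> carrier B \<and> rle B x y \<or>
     x \<in> carrier C \<and> y \<in> carrier C \<and> rle C x y \<or> x \<in> N \<and> y \<in> Cm"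

lemma gle_B: "\<lbrakk>x \<in> carrier B; y \<in> carrier B\<rbrakk> \<Longrightarrow> gle x y \<longleftrightarrow> rle B x y"
  using Cm_notin(1) agree_ops(6) by (auto simp: gle_def)

lemma gle_C: "\<lbrakk>x \<in> carrier C; y \<in> carrier C\<rbrakk> \<Longrightarrow> gle x y \<longleftrightarrow> rle C x y"
  using agree_ops(6)[of x y] ideal_below_C[of x y] Cm_notin(3)[of y] in_both_iff[of x]
  by (auto simp: gle_def rless_def)

lemma gle_N_upper: "\<lbrakk>x \<in> N; y \<in> Cm \<or> y \<in> F\<rbrakk> \<Longrightarrow> gle x y"
  using B.below_filter filter_carrier by (auto simp: gle_def)

lemma gle_Cm_F: "\<lbrakk>x \<in> Cm; y \<in> F\<rbrakk> \<Longrightarrow> gle x y"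
  using filter_above_C filter_carrier Cm_C Cm_notin(2) by (auto simp: gle_def rless_def)

lemma not_gle_N:
  assumes "x \<in> Cm \<or> x \<in> F" "y \<in> N"
  shows "\<not> gle x y"
proof
  assume le: "gle x y"
  from assms(1) show False
  proof
    assume "x \<in> F"
    then show False
      using le assms(2) B.filter_up[of x y] filter_carrier(1)[of x] by (simp add: gle_B)
  next
    assume "x \<in> Cm"
    then have "y \<in> carrier C" "rle C x y" "x \<notin> I" "x \<in> carrier C"
      using le assms(2) Cm_notin Cm_C by (auto simp: gle_def)
    moreover from this have "y \<in> I" using assms(2) in_both_iff[of y] by simp
    ultimately show False using ideal_down_C by blast
  qed
qed

lemma not_gle_F_Cm: "\<lbrakk>x \<in> F; y \<in> Cm\<rbrakk> \<Longrightarrow> \<not> gle x y"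
  using filter_up_C[of x y] filter_carrier(2)[of x] Cm_C[of y] Cm_notin(2)[of y]
  by (auto simp: gle_C)

lemmas gle_levels = gle_N_upper gle_Cm_F not_gle_N not_gle_F_Cm

lemma gle_refl: "x \<in> carrier D \<Longrightarrow> gle x x"
  using B.le_refl C.le_refl by (auto simp: gle_def)

lemma gle_antisym:
  assumes "gle x y" "gle y x" "x \<in> carrier D" "y \<in> carrier D"
  shows "x = y"
  using assms(3,4,1,2)
  by (elim D_cases) (simp_all add: gle_levels gle_B gle_C Cm_C filter_carrier,
      (meson B.le_antisym C.le_antisym Cm_C filter_carrier)+)

lemma gle_trans:
  assumes "gle x y" "gle y z" "x \<in> carrier D" "y \<in> carrier D" "z \<in> carrier D"
  shows "gle x z"
  using assms(3-5,1,2)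
  by (elim D_cases) (simp_all add: gle_levels gle_B gle_C Cm_C filter_carrier,
      (meson B.le_trans C.le_trans Cm_C filter_carrier)+)

section \<open>Meets and joins in the ordinal-sum order\<close>

text \<open>The product lies below the meet and is outside \<open>I\<close>, so the meet is outside
  \<open>I\<close> too. Hence the exceptional branch of \<open>rmeet\<close> is never taken here;
  that of \<open>rjoin\<close> still may be.\<close>

lemma Cm_meet:
  assumes "x \<in> Cm" "y \<in> Cm"
  shows "x \<curlywedge>\<^bsub>C\<^esub> y \<in> Cm"
proof -
  note xy = Cm_C[OF assms(1)] Cm_C[OF assms(2)]
  have "rle C (x \<otimes>\<^bsub>C\<^esub> y) (x \<curlywedge>\<^bsub>C\<^esub> y)"
    using xy by (simp add: C.le_meet_iff C.mult_le1 C.mult_le2)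
  then have "x \<curlywedge>\<^bsub>C\<^esub> y \<notin> I" using ideal_down_C xy Cm_notin(3)[OF Cm_mult[OF assms]] by blast
  moreover have "x \<curlywedge>\<^bsub>C\<^esub> y \<notin> F"
    using filter_up_C C.meet_le1[OF xy] xy Cm_notin(2)[OF assms(1)] by blast
  ultimately show ?thesis using xy by (simp add: minus_part_def C.meet_closed)
qed

lemma N_down: "\<lbrakk>rle B x y; y \<in> N; x \<in> carrier B\<rbrakk> \<Longrightarrow> x \<in> N"
  using B.filter_up by blast

lemma glue_meet:
  "\<lbrakk>x \<in> Cm; y \<in> Cm\<rbrakk> \<Longrightarrow> x \<curlywedge>\<^bsub>D\<^esub> y = x \<curlywedge>\<^bsub>C\<^esub> y"
  "\<lbrakk>x \<in> Cm; y \<in> F\<rbrakk> \<Longrightarrow> x \<curlywedge>\<^bsub>D\<^esub> y = x"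
  "\<lbrakk>x \<in> Cm; y \<in> F\<rbrakk> \<Longrightarrow> y \<curlywedge>\<^bsub>D\<^esub> x = x"
  "\<lbrakk>x \<in> Cm; y \<in> N\<rbrakk> \<Longrightarrow> x \<curlywedge>\<^bsub>D\<^esub> y = y"
  "\<lbrakk>x \<in> Cm; y \<in> N\<rbrakk> \<Longrightarrow> y \<curlywedge>\<^bsub>D\<^esub> x = y"
proof -
  assume x: "x \<in> Cm"
  note x' = Cm_C[OF x] Cm_notin[OF x]
  have xBm: "x \<notin> Bm" using x' Bm_B by blast
  show "x \<curlywedge>\<^bsub>D\<^esub> y = x \<curlywedge>\<^bsub>C\<^esub> y" if "y \<in> Cm"
    using x x' that Cm_C Cm_notin Cm_notin(3)[OF Cm_meet[OF x that]] by (simp add: glue_def)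
  show "x \<curlywedge>\<^bsub>D\<^esub> y = x" "y \<curlywedge>\<^bsub>D\<^esub> x = x" if "y \<in> F"
  proof -
    have "rle C x y" using filter_above_C[OF that] x' by (simp add: rless_def)
    then have "x \<curlywedge>\<^bsub>C\<^esub> y = x" "y \<curlywedge>\<^bsub>C\<^esub> x = x"
      using C.meet_comm x' filter_carrier[OF that] by (auto simp: rle_def)
    then show "x \<curlywedge>\<^bsub>D\<^esub> y = x" "y \<curlywedge>\<^bsub>D\<^esub> x = x"
      using x' that filter_carrier[OF that] by (simp_all add: glue_def minus_part_def)
  qed
  show "x \<curlywedge>\<^bsub>D\<^esub> y = y" "y \<curlywedge>\<^bsub>D\<^esub> x = y" if y: "y \<in> N"
  proof -
    have "x \<curlywedge>\<^bsub>D\<^esub> y = y \<and> y \<curlywedge>\<^bsub>D\<^esub> x = y"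
    proof (cases "y \<in> I")
      case True
      have "rle C y x" using ideal_below_C[OF True] x' by (simp add: rless_def)
      then have "x \<curlywedge>\<^bsub>C\<^esub> y = y" "y \<curlywedge>\<^bsub>C\<^esub> x = y"
        using C.meet_comm x' ideal_carrier[OF True] by (auto simp: rle_def)
      then show ?thesis
        using x' True ideal_carrier[OF True] by (simp add: glue_def minus_part_def)
    next
      case False
      then have "y \<in> Bm" "y \<notin> carrier C" using y N_iff Bm_notin by auto
      then show ?thesis using x' xBm by (simp add: glue_def)
    qed
    then show "x \<curlywedge>\<^bsub>D\<^esub> y = y" "y \<curlywedge>\<^bsub>D\<^esub> x = y" by auto
  qed
qed

text \<open>Either both elements lie in the ideal or they are comparable. Thus the exceptional
  branch of \<open>rjoin\<close> concerns \<open>Bm\<close> only, and the join rule on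
  \<open>N\<close> can treat \<open>I\<close> and \<open>Bm\<close> together.\<close>

lemma N_join_ideal:
  assumes "x \<in> N" "y \<in> N" "x \<in> I \<or> y \<in> I"
  shows "x \<curlyvee>\<^bsub>B\<^esub> y \<in> N"
proof -
  have *: "u \<curlyvee>\<^bsub>B\<^esub> v \<in> N" if "u \<in> I" "v \<in> N" for u v
  proof (cases "v \<in> I")
    case True
    then have "u \<curlyvee>\<^bsub>C\<^esub> v \<in> I" using that ideal by (simp add: lattice_ideal_def)
    then show ?thesis using agree_ops(3) that True ideal_carrier N_iff by metis
  next
    case False
    then have "rle B u v" using ideal_below_B that by (simp add: rless_def)
    then show ?thesis using B.le_iff_join ideal_carrier that by simp
  qed
  then show ?thesis using assms B.join_comm by (metis DiffD1)
qed

lemma glue_join: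
  "\<lbrakk>x \<in> N; y \<in> N\<rbrakk> \<Longrightarrow>
    x \<curlyvee>\<^bsub>D\<^esub> y = (if x \<curlyvee>\<^bsub>B\<^esub> y \<in> F then bot_above C I else x \<curlyvee>\<^bsub>B\<^esub> y)"
  "\<lbrakk>x \<in> N; y \<in> F\<rbrakk> \<Longrightarrow> x \<curlyvee>\<^bsub>D\<^esub> y = y"
  "\<lbrakk>x \<in> N; y \<in> F\<rbrakk> \<Longrightarrow> y \<curlyvee>\<^bsub>D\<^esub> x = y"
  "\<lbrakk>x \<in> N; y \<in> Cm\<rbrakk> \<Longrightarrow> x \<curlyvee>\<^bsub>D\<^esub> y = y"
  "\<lbrakk>x \<in> N; y \<in> Cm\<rbrakk> \<Longrightarrow> y \<curlyvee>\<^bsub>D\<^esub> x = y"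
proof -
  assume x: "x \<in> N"
  show "x \<curlyvee>\<^bsub>D\<^esub> y = (if x \<curlyvee>\<^bsub>B\<^esub> y \<in> F then bot_above C I else x \<curlyvee>\<^bsub>B\<^esub> y)" if y: "y \<in> N"
  proof (cases "x \<in> I \<or> y \<in> I")
    case True
    then have "x \<curlyvee>\<^bsub>B\<^esub> y \<notin> F" using N_join_ideal x y by blast
    then show ?thesis using x y agree_ops(3)[of x y] by (auto simp: glue_def)
  next
    case False
    then have "x \<in> Bm" "y \<in> Bm" using x y by (auto simp: minus_part_def)
    then show ?thesis using x y Bm_notin by (simp add: glue_def)
  qed
  show "x \<curlyvee>\<^bsub>D\<^esub> y = y" "y \<curlyvee>\<^bsub>D\<^esub> x = y" if y: "y \<in> F"
  proof -
    have "rle B x y" using B.below_filter x y by simp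
    then have "x \<curlyvee>\<^bsub>B\<^esub> y = y" "y \<curlyvee>\<^bsub>B\<^esub> x = y"
      using B.le_iff_join[of x y] B.join_comm x filter_carrier[OF y] by auto
    then show "x \<curlyvee>\<^bsub>D\<^esub> y = y" "y \<curlyvee>\<^bsub>D\<^esub> x = y"
      using x y filter_carrier[OF y] agree_ops(3)[of x y] agree_ops(3)[of y x]
      by (auto simp: glue_def minus_part_def)
  qed
  show "x \<curlyvee>\<^bsub>D\<^esub> y = y" "y \<curlyvee>\<^bsub>D\<^esub> x = y" if y: "y \<in> Cm"
  proof -
    note y' = Cm_C[OF y] Cm_notin[OF y]
    have "x \<curlyvee>\<^bsub>D\<^esub> y = y \<and> y \<curlyvee>\<^bsub>D\<^esub> x = y"
    proof (cases "x \<in> I")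
      case True
      have "rle C x y" using ideal_below_C[OF True] y' by (simp add: rless_def)
      then have "x \<curlyvee>\<^bsub>C\<^esub> y = y" "y \<curlyvee>\<^bsub>C\<^esub> x = y"
        using C.le_iff_join[of x y] C.join_comm y' ideal_carrier[OF True] by auto
      then show ?thesis using y' True ideal_carrier[OF True] by (simp add: glue_C)
    next
      case False
      then have "x \<in> Bm" "x \<notin> carrier C" using x N_iff Bm_notin by auto
      then show ?thesis using y' Bm_B by (auto simp: glue_def)
    qed
    then show "x \<curlyvee>\<^bsub>D\<^esub> y = y" "y \<curlyvee>\<^bsub>D\<^esub> x = y" by auto
  qed
qed

text \<open>Clause (3) supplies the bottom of \<open>carrier C - I\<close>. It is not in
  \<open>F\<close>, for otherwise an element of \<open>Cm\<close> above it would be in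
  \<open>F\<close> as well.\<close>

lemma bot_above_min:
  assumes "x \<in> N" "y \<in> N" "x \<curlyvee>\<^bsub>B\<^esub> y \<in> F"
  shows "bot_above C I \<in> Cm" and "c \<in> Cm \<Longrightarrow> rle C (bot_above C I) c"
proof -
  obtain m where m: "is_min C (carrier C - I) m"
    using quad assms unfolding compatible_quadruple_def by blast
  have eq: "bot_above C I = m"
    unfolding bot_above_def using the_is_min[OF C.irl_axioms m] by blast
  have le: "rle C m c" if "c \<in> Cm" for c
    using m that Cm_C Cm_notin by (simp add: is_min_def)
  obtain c' where c': "c' \<in> Cm" using Cm_nonempty by blast
  have "m \<notin> F" using le[OF c'] filter_up_C c' Cm_C Cm_notin(2) by blast
  then show "bot_above C I \<in> Cm" using m by (simp add: eq is_min_def minus_part_def)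
  show "c \<in> Cm \<Longrightarrow> rle C (bot_above C I) c" using le by (simp add: eq)
qed

text \<open>Coarser splits than \<open>D_cases\<close>: here \<open>B\<close> is kept whole, in
  \<open>D_cases_C\<close> all of \<open>C\<close> outside \<open>I\<close>, so that the laws of
  that algebra apply without further cases.\<close>

lemma D_cases_B:
  assumes "x \<in> carrier D"
  obtains "x \<in> carrier B" | "x \<in> Cm"
  using assms filter_carrier by (elim D_cases) auto

lemma D_cases_C:
  assumes "x \<in> carrier D"
  obtains "x \<in> N" | "x \<in> carrier C - I"
  using assms C_iff disj Cm_notin(3) by (elim D_cases) auto

lemma upper_iff: "x \<in> carrier C - I \<longleftrightarrow> x \<in> Cm \<or> x \<in> F"
  using C_iff disj Cm_notin(3) by auto

lemma gle_Cm_B: "\<lbrakk>c \<in> Cm; x \<in> carrier B\<rbrakk> \<Longrightarrow> gle c x \<longleftrightarrow> x \<in> F"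
  using gle_Cm_F not_gle_N by blast

lemma gle_N_C: "\<lbrakk>x \<in> N; c \<in> carrier C - I\<rbrakk> \<Longrightarrow> gle x c"
  using gle_N_upper upper_iff by blast

lemma not_gle_C_N: "\<lbrakk>x \<in> N; c \<in> carrier C - I\<rbrakk> \<Longrightarrow> \<not> gle c x"
  using not_gle_N upper_iff by blast

lemma gle_Bm_C: "\<lbrakk>b \<in> Bm; x \<in> carrier C\<rbrakk> \<Longrightarrow> gle b x \<longleftrightarrow> x \<notin> I"
  using gle_N_C[of b x] gle_B[of b x] ideal_down_B[of x b] N_iff Bm_B Bm_notin(3) ideal_carrier(1)
  by blast

lemma upper_up: "\<lbrakk>rle C x y; x \<in> carrier C - I; y \<in> carrier C\<rbrakk> \<Longrightarrow> y \<in> carrier C - I"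
  using ideal_down_C by blast

text \<open>The product of two filter elements lies below their meet. With \<open>gle_Cm_B\<close>
  this decides when an element of \<open>Cm\<close> lies below a meet taken in
  \<open>B\<close>.\<close>

lemma meet_in_filter_iff:
  assumes "x \<in> carrier B" "y \<in> carrier B"
  shows "x \<curlywedge>\<^bsub>B\<^esub> y \<in> F \<longleftrightarrow> x \<in> F \<and> y \<in> F"
proof
  show "x \<curlywedge>\<^bsub>B\<^esub> y \<in> F \<Longrightarrow> x \<in> F \<and> y \<in> F"
    using assms B.filter_up B.meet_le1 B.meet_le2 by blast
  assume "x \<in> F \<and> y \<in> F"
  moreover have "rle B (x \<otimes>\<^bsub>B\<^esub> y) (x \<curlywedge>\<^bsub>B\<^esub> y)"
    using assms by (simp add: B.le_meet_iff B.mult_le1 B.mult_le2)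
  ultimately show "x \<curlywedge>\<^bsub>B\<^esub> y \<in> F"
    using assms B.filter_up[OF B.filter_mult] B.meet_closed by blast
qed

lemma glue_meet_closed:
  assumes "x \<in> carrier D" "y \<in> carrier D"
  shows "x \<curlywedge>\<^bsub>D\<^esub> y \<in> carrier D"
  using assms
  by (elim D_cases)
    (simp_all add: glue_B(2) glue_meet filter_carrier Cm_C B.meet_closed C.meet_closed)

lemma gle_meet_iff:
  assumes "x \<in> carrier D" "y \<in> carrier D" and z: "z \<in> carrier D"
  shows "gle z (x \<curlywedge>\<^bsub>D\<^esub> y) \<longleftrightarrow> gle z x \<and> gle z y"
proof -
  \<comment> \<open>An element c of \<open>Cm\<close> is comparable with all of \<open>B\<close>, so
    the meet is one of the two arguments.\<close>
  have mixed: "gle z (x \<curlywedge>\<^bsub>D\<^esub> c) \<longleftrightarrow> gle z x \<and> gle z c"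
    "gle z (c \<curlywedge>\<^bsub>D\<^esub> x) \<longleftrightarrow> gle z x \<and> gle z c"
    if "x \<in> carrier B" "c \<in> Cm" for x c
    using z that by (cases "x \<in> F"; elim D_cases; simp add: glue_meet gle_levels)+
  from assms(1) show ?thesis
  proof (cases rule: D_cases_B)
    case x: 1
    from assms(2) show ?thesis
    proof (cases rule: D_cases_B)
      case y: 1
      from z show ?thesis
        by (cases rule: D_cases_B)
          (use x y in \<open>simp_all add: glue_B(2) gle_B gle_Cm_B B.meet_closed B.le_meet_iff
            meet_in_filter_iff\<close>)
    next
      case 2
      then show ?thesis using mixed x by blast
    qed
  next
    case x: 2
    from assms(2) show ?thesis
    proof (cases rule: D_cases_B)
      case 1
      then show ?thesis using mixed x by blast
    next
      case y: 2
      note xy = Cm_C[OF x] Cm_C[OF y] Cm_meet[OF x y]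
      from z show ?thesis
      proof (cases rule: D_cases_C)
        case 1
        then show ?thesis using x y xy by (simp add: glue_meet gle_N_upper)
      next
        case 2
        then show ?thesis
          using x y xy by (simp add: glue_meet gle_C C.meet_closed C.le_meet_iff)
      qed
    qed
  qed
qed

lemma glue_join_closed:
  assumes "x \<in> carrier D" "y \<in> carrier D"
  shows "x \<curlyvee>\<^bsub>D\<^esub> y \<in> carrier D"
  using assms bot_above_min(1) Cm_C
  by (elim D_cases)
    (simp_all add: glue_C(2) glue_join filter_carrier Cm_C B.join_closed C.join_closed)

lemma gle_join_iff:
  assumes "x \<in> carrier D" "y \<in> carrier D" and z: "z \<in> carrier D"
  shows "gle (x \<curlyvee>\<^bsub>D\<^esub> y) z \<longleftrightarrow> gle x z \<and> gle y z"
proof -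
  have mixed: "gle (x \<curlyvee>\<^bsub>D\<^esub> c) z \<longleftrightarrow> gle x z \<and> gle c z"
    "gle (c \<curlyvee>\<^bsub>D\<^esub> x) z \<longleftrightarrow> gle x z \<and> gle c z"
    if x: "x \<in> N" and c: "c \<in> carrier C - I" for x c
  proof -
    have "x \<curlyvee>\<^bsub>D\<^esub> c = c" "c \<curlyvee>\<^bsub>D\<^esub> x = c" using x c upper_iff glue_join(2-5) by blast+
    moreover have "gle c z \<longrightarrow> gle x z"
      using z x c gle_N_C not_gle_C_N by (cases rule: D_cases_C) blast+
    ultimately show "gle (x \<curlyvee>\<^bsub>D\<^esub> c) z \<longleftrightarrow> gle x z \<and> gle c z"
      "gle (c \<curlyvee>\<^bsub>D\<^esub> x) z \<longleftrightarrow> gle x z \<and> gle c z" by auto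
  qed
  from assms(1) show ?thesis
  proof (cases rule: D_cases_C)
    case x: 1
    from assms(2) show ?thesis
    proof (cases rule: D_cases_C)
      case y: 1
      have join: "x \<curlyvee>\<^bsub>B\<^esub> y \<in> carrier B" using x y by (simp add: B.join_closed)
      show ?thesis
      proof (cases "x \<curlyvee>\<^bsub>B\<^esub> y \<in> F")
        case True
        note bot = bot_above_min[OF x y True]
        \<comment> \<open>No element of \<open>N\<close> bounds both arguments, as their join in
          \<open>B\<close> lies in \<open>F\<close>, whereas every element of \<open>Cm\<close>
          does. The least upper bound is therefore the bottom of \<open>Cm\<close>.\<close>
        have eq: "x \<curlyvee>\<^bsub>D\<^esub> y = bot_above C I" using glue_join(1)[OF x y] True by simp
        from z show ?thesis
        proof (cases rule: D_cases)
          case 1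
          then have "\<not> rle B (x \<curlyvee>\<^bsub>B\<^esub> y) z" using True join N_down by blast
          then have "\<not> (gle x z \<and> gle y z)" using 1 x y by (simp add: gle_B B.join_le_iff)
          then show ?thesis using eq bot(1) 1 not_gle_N by simp
        next
          case 2
          then show ?thesis using eq bot x y by (simp add: gle_levels gle_C Cm_C)
        next
          case 3
          then show ?thesis using eq bot(1) x y by (simp add: gle_levels)
        qed
      next
        case False
        then have eq: "x \<curlyvee>\<^bsub>D\<^esub> y = x \<curlyvee>\<^bsub>B\<^esub> y" using glue_join(1)[OF x y] by simp
        from z show ?thesis
        proof (cases rule: D_cases_B)
          case 1
          then show ?thesis using eq join x y by (simp add: gle_B B.join_le_iff)
        next
          case 2
          then show ?thesis using eq join False x y by (simp add: gle_levels)
        qed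
      qed
    next
      case 2
      then show ?thesis using mixed x by blast
    qed
  next
    case x: 2
    from assms(2) show ?thesis
    proof (cases rule: D_cases_C)
      case 1
      then show ?thesis using mixed x by blast
    next
      case y: 2
      have join: "x \<curlyvee>\<^bsub>D\<^esub> y = x \<curlyvee>\<^bsub>C\<^esub> y" "x \<curlyvee>\<^bsub>C\<^esub> y \<in> carrier C - I"
        using x y upper_up[OF C.join_ge1[of x y]] by (simp_all add: glue_C(2) C.join_closed)
      from z show ?thesis
      proof (cases rule: D_cases_C)
        case 1
        then show ?thesis using x y join not_gle_C_N by simp
      next
        case 2
        then show ?thesis using x y join by (simp add: gle_C C.join_le_iff)
      qed
    qed
  qed
qed

section \<open>Divisions across the levels, and residuation\<close>

lemma glue_div_N_Cm:
  assumes "x \<in> N" "z \<in> Cm"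
  shows "ldiv D x z = \<one>\<^bsub>B\<^esub>" "rdiv D z x = \<one>\<^bsub>B\<^esub>"
proof -
  note z = Cm_C[OF assms(2)] Cm_notin[OF assms(2)]
  have "ldiv D x z = \<one>\<^bsub>B\<^esub> \<and> rdiv D z x = \<one>\<^bsub>B\<^esub>"
  proof (cases "x \<in> I")
    case True
    then have "rle C x z" using ideal_below_C z by (simp add: rless_def)
    then show ?thesis
      using z True ideal_carrier[OF True]
      by (simp add: glue_C C.ldiv_eq_one_iff C.rdiv_eq_one_iff one_eq)
  next
    case False
    then have "x \<in> Bm" "x \<notin> carrier C" using assms N_iff Bm_notin by auto
    then show ?thesis using z by (simp add: glue_def)
  qed
  then show "ldiv D x z = \<one>\<^bsub>B\<^esub>" "rdiv D z x = \<one>\<^bsub>B\<^esub>" by auto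
qed

text \<open>Without \<open>I\<close>-divisors the branches with \<open>ell\<close> and
  \<open>arr\<close> are not taken.\<close>

lemma glue_div_Cm_Bm:
  assumes "x \<in> Cm" "z \<in> Bm"
  shows "ldiv D x z = gamma B F z" "rdiv D z x = gamma B F z"
  using Cm_notin[OF assms(1)] Bm_notin[OF assms(2)] Bm_B[of x] no_divisors
  by (auto simp: glue_def)

lemma glue_div_closed:
  assumes "x \<in> carrier D" "z \<in> carrier D"
  shows "ldiv D x z \<in> carrier D" "rdiv D z x \<in> carrier D"
proof -
  have "ldiv D x z \<in> carrier D \<and> rdiv D z x \<in> carrier D"
  proof (cases "x \<in> carrier B \<and> z \<in> carrier B \<or> x \<in> carrier C \<and> z \<in> carrier C")
    case True
    then show ?thesis
      by (auto simp: glue_B glue_C B.ldiv_closed B.rdiv_closed C.ldiv_closed C.rdiv_closed)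
  next
    case False
    have "x \<in> N \<and> z \<in> Cm \<or> x \<in> Cm \<and> z \<in> Bm"
    proof (cases "x \<in> carrier B")
      case True
      then have "z \<notin> carrier B" "x \<notin> carrier C" using False assms by auto
      then show ?thesis using True assms(2) filter_carrier ideal_carrier by (auto simp: minus_part_def)
    next
      case nB: False
      then have "x \<in> Cm" using assms(1) by (elim D_cases_B) auto
      moreover have "z \<in> carrier B" "z \<notin> carrier C" using nB False assms by auto
      ultimately show ?thesis using filter_carrier ideal_carrier by (auto simp: minus_part_def)
    qed
    then consider "x \<in> N" "z \<in> Cm" | "x \<in> Cm" "z \<in> Bm" by blast
    then show ?thesis
      by cases (auto simp: glue_div_N_Cm glue_div_Cm_Bm B.gamma_carrier[OF lower] Bm_B Bm_notin)
  qed
  then show "ldiv D x z \<in> carrier D" "rdiv D z x \<in> carrier D" by auto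
qed

text \<open>The product of x with the residual lies below z, and z lies below the residual;
  \<open>F\<close> is closed under products and upwards.\<close>

lemma ldiv_filter_iff: "\<lbrakk>x \<in> F; z \<in> carrier B\<rbrakk> \<Longrightarrow> ldiv B x z \<in> F \<longleftrightarrow> z \<in> F"
  and rdiv_filter_iff: "\<lbrakk>x \<in> F; z \<in> carrier B\<rbrakk> \<Longrightarrow> rdiv B z x \<in> F \<longleftrightarrow> z \<in> F"
  using B.filter_up[OF B.filter_mult B.mult_ldiv_le] B.filter_up[OF _ B.le_ldiv]
    B.filter_up[OF B.filter_mult B.rdiv_mult_le] B.filter_up[OF _ B.le_rdiv]
    filter_carrier(1) B.ldiv_closed B.rdiv_closed by metis+

text \<open>A product of x with an element of \<open>C\<close> outside \<open>I\<close> stays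
  outside \<open>I\<close>, whereas x times its residual into z lies below z and so in
  \<open>I\<close>.\<close>

lemma div_Cm_ideal:
  assumes x: "x \<in> Cm" and z: "z \<in> I"
  shows "ldiv C x z \<in> I" "rdiv C z x \<in> I"
proof -
  have prod: "u \<otimes>\<^bsub>C\<^esub> x \<notin> I" "x \<otimes>\<^bsub>C\<^esub> u \<notin> I" if "u \<in> carrier C - I" for u
    using that[unfolded upper_iff] Cm_notin(3) Cm_mult[OF _ x] Cm_mult[OF x] Cm_mult_filter[OF x]
    by blast+
  note xz = Cm_C[OF x] ideal_carrier(2)[OF z]
  have "x \<otimes>\<^bsub>C\<^esub> ldiv C x z \<in> I" "rdiv C z x \<otimes>\<^bsub>C\<^esub> x \<in> I"
    using ideal_down_C[OF z] C.mult_ldiv_le C.rdiv_mult_le C.ldiv_closed C.rdiv_closed xz by simp_all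
  then show "ldiv C x z \<in> I" "rdiv C z x \<in> I"
    using prod[of "rdiv C z x"] prod[of "ldiv C x z"] xz by (auto simp: C.ldiv_closed C.rdiv_closed)
qed

text \<open>The cases are the placements of x and z. For x in \<open>N\<close>, z in
  \<open>B\<close> and y in \<open>Cm\<close>, residuation is the criterion relating
  \<open>sigma\<close> to residuals in \<open>F\<close>; for x in \<open>Cm\<close>, z in
  \<open>Bm\<close> and y in \<open>N\<close> it is the adjunction of \<open>sigma\<close> and
  \<open>gamma\<close>. For x, z in \<open>C\<close> and y in \<open>Bm\<close> only membership in
  \<open>I\<close> matters.\<close>

lemma glue_ldiv_residual:
  assumes x: "x \<in> carrier D" and y: "y \<in> carrier D" and z: "z \<in> carrier D"
  shows "gle (x \<otimes>\<^bsub>D\<^esub> y) z \<longleftrightarrow> gle y (ldiv D x z)"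
proof (cases "x \<in> carrier B \<and> z \<in> carrier B")
  case True
  then have ldiv: "ldiv D x z = ldiv B x z" "ldiv B x z \<in> carrier B"
    by (simp_all add: glue_B B.ldiv_closed)
  from y show ?thesis
  proof (cases rule: D_cases_B)
    case 1
    then show ?thesis using True ldiv by (simp add: glue_B gle_B B.ldiv_residual)
  next
    case 2
    show ?thesis
    proof (cases "x \<in> F")
      case xF: True
      then have "x \<otimes>\<^bsub>D\<^esub> y \<in> Cm" using 2 by (simp add: glue_C filter_carrier Cm_C Cm_mult_filter)
      then show ?thesis using 2 xF True ldiv by (simp add: gle_Cm_B ldiv_filter_iff)
    next
      case False
      then show ?thesis
        using 2 True ldiv
        by (simp add: gle_Cm_B glue_mult_mixed gle_B B.sigma_carrier B.sigma_le_iff_ldiv)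
    qed
  qed
next
  case not_B: False
  show ?thesis
  proof (cases "x \<in> N")
    case True
    \<comment> \<open>Both sides hold in this case: x y stays in \<open>N\<close> and so lies below
      z, and the residual is 1.\<close>
    then have "z \<in> Cm" using z not_B filter_carrier by (elim D_cases) auto
    moreover have "x \<otimes>\<^bsub>D\<^esub> y \<in> N"
      using y by (cases rule: D_cases_B)
        (use True N_mult sigma_N in \<open>simp_all add: glue_B glue_mult_mixed\<close>)
    moreover have "gle y \<one>\<^bsub>B\<^esub>"
      using y B.one_in_filter filter_carrier
      by (elim D_cases) (simp_all add: gle_levels gle_B B.one_top)
    ultimately show ?thesis using True by (simp add: gle_levels glue_div_N_Cm)
  next
    case False
    then have xC: "x \<in> carrier C - I" using x by (elim D_cases_C) auto
    show ?thesis
    proof (cases "z \<in> carrier C")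
      case zC: True
      then have ldiv: "ldiv D x z = ldiv C x z" "ldiv C x z \<in> carrier C"
        using xC by (simp_all add: glue_C C.ldiv_closed)
      show ?thesis
      proof (cases "y \<in> carrier C")
        case True
        then show ?thesis using xC zC ldiv by (simp add: glue_C gle_C C.ldiv_residual)
      next
        case False
        then have yB: "y \<in> Bm" using y ideal_carrier filter_carrier Cm_C N_iff by (elim D_cases) auto
        then have yN: "y \<in> N" using N_iff by blast
        \<comment> \<open>Multiplication by x keeps y in \<open>Bm\<close>, and an element of
          \<open>Bm\<close> lies below an element of \<open>C\<close> exactly when the latter is
          outside \<open>I\<close>.\<close>
        have "x \<otimes>\<^bsub>D\<^esub> y \<in> Bm"
        proof (cases "x \<in> F")
          case True
          have "x \<otimes>\<^bsub>B\<^esub> y \<in> N" using N_mult(2)[OF yN] True filter_carrier by blast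
          moreover have "x \<otimes>\<^bsub>B\<^esub> y \<notin> I"
            using ideal_prime_B True yB Bm_B Bm_notin(3) by blast
          ultimately show ?thesis using True yB by (simp add: glue_B filter_carrier Bm_B minus_part_def)
        next
          case False
          then have "x \<in> Cm" using xC upper_iff by blast
          then show ?thesis using yN yB by (simp add: glue_mult_mixed sigma_Bm)
        qed
        then have "gle (x \<otimes>\<^bsub>D\<^esub> y) z \<longleftrightarrow> z \<notin> I" using gle_Bm_C zC by blast
        also have "\<dots> \<longleftrightarrow> ldiv C x z \<notin> I"
        proof (cases "z \<in> I")
          case True
          \<comment> \<open>An x in \<open>F\<close> would place both x and z in
            \<open>B\<close>.\<close>
          then have "x \<in> Cm" using not_B xC upper_iff ideal_carrier filter_carrier by blast
          then show ?thesis using True div_Cm_ideal by simp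
        next
          case False
          then show ?thesis using upper_up[OF C.le_ldiv[of x z]] xC zC ldiv by auto
        qed
        also have "\<dots> \<longleftrightarrow> gle y (ldiv D x z)" using gle_Bm_C yB ldiv by simp
        finally show ?thesis .
      qed
    next
      case False
      then have zB: "z \<in> Bm" using z ideal_carrier filter_carrier Cm_C N_iff by (elim D_cases) auto
      then have xCm: "x \<in> Cm" using not_B xC upper_iff filter_carrier Bm_B by blast
      have zN: "z \<in> carrier B" "z \<notin> F" using zB Bm_B Bm_notin by auto
      note gamma = B.gamma_residual[OF lower zN]
      from y show ?thesis
      proof (cases rule: D_cases)
        case 1
        then show ?thesis
          using xCm zB zN gamma
          by (simp add: glue_mult_mixed glue_div_Cm_Bm gle_B B.sigma_carrier)
      next
        \<comment> \<open>For y in \<open>Cm\<close> or \<open>F\<close> both sides fail: y and x y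
          are above \<open>N\<close>, while z and gamma(z) lie in it.\<close>
        case 2
        then have "x \<otimes>\<^bsub>D\<^esub> y \<in> Cm" using xCm by (simp add: glue_C Cm_C Cm_mult)
        then show ?thesis using 2 xCm zB zN gamma by (simp add: glue_div_Cm_Bm gle_Cm_B)
      next
        case 3
        then have "x \<otimes>\<^bsub>D\<^esub> y \<in> Cm"
          using xCm by (simp add: glue_C Cm_C filter_carrier Cm_mult_filter)
        then show ?thesis using 3 xCm zB zN gamma by (simp add: glue_div_Cm_Bm not_gle_N)
      qed
    qed
  qed
qed

text \<open>The left-right mirror of \<open>glue_ldiv_residual\<close>: x is now the right factor
  and the divisor, and the criterion for \<open>sigma\<close> is used in its form with
  \<open>rdiv\<close>. The adjunction with \<open>gamma\<close> has no sides and serves both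
  times.\<close>

lemma glue_rdiv_residual:
  assumes x: "x \<in> carrier D" and y: "y \<in> carrier D" and z: "z \<in> carrier D"
  shows "gle (y \<otimes>\<^bsub>D\<^esub> x) z \<longleftrightarrow> gle y (rdiv D z x)"
proof (cases "x \<in> carrier B \<and> z \<in> carrier B")
  case True
  then have rdiv: "rdiv D z x = rdiv B z x" "rdiv B z x \<in> carrier B"
    by (simp_all add: glue_B B.rdiv_closed)
  from y show ?thesis
  proof (cases rule: D_cases_B)
    case 1
    then show ?thesis using True rdiv by (simp add: glue_B gle_B B.rdiv_residual)
  next
    case 2
    show ?thesis
    proof (cases "x \<in> F")
      case xF: True
      then have "y \<otimes>\<^bsub>D\<^esub> x \<in> Cm" using 2 by (simp add: glue_C filter_carrier Cm_C Cm_mult_filter)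
      then show ?thesis using 2 xF True rdiv by (simp add: gle_Cm_B rdiv_filter_iff)
    next
      case False
      then show ?thesis
        using 2 True rdiv
        by (simp add: gle_Cm_B glue_mult_mixed gle_B B.sigma_carrier B.sigma_le_iff_rdiv)
    qed
  qed
next
  case not_B: False
  show ?thesis
  proof (cases "x \<in> N")
    case True
    then have "z \<in> Cm" using z not_B filter_carrier by (elim D_cases) auto
    moreover have "y \<otimes>\<^bsub>D\<^esub> x \<in> N"
      using y by (cases rule: D_cases_B)
        (use True N_mult sigma_N in \<open>simp_all add: glue_B glue_mult_mixed\<close>)
    moreover have "gle y \<one>\<^bsub>B\<^esub>"
      using y B.one_in_filter filter_carrier
      by (elim D_cases) (simp_all add: gle_levels gle_B B.one_top)
    ultimately show ?thesis using True by (simp add: gle_levels glue_div_N_Cm)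
  next
    case False
    then have xC: "x \<in> carrier C - I" using x by (elim D_cases_C) auto
    show ?thesis
    proof (cases "z \<in> carrier C")
      case zC: True
      then have rdiv: "rdiv D z x = rdiv C z x" "rdiv C z x \<in> carrier C"
        using xC by (simp_all add: glue_C C.rdiv_closed)
      show ?thesis
      proof (cases "y \<in> carrier C")
        case True
        then show ?thesis using xC zC rdiv by (simp add: glue_C gle_C C.rdiv_residual)
      next
        case False
        then have yB: "y \<in> Bm" using y ideal_carrier filter_carrier Cm_C N_iff by (elim D_cases) auto
        then have yN: "y \<in> N" using N_iff by blast
        have "y \<otimes>\<^bsub>D\<^esub> x \<in> Bm"
        proof (cases "x \<in> F")
          case True
          have "y \<otimes>\<^bsub>B\<^esub> x \<in> N" using N_mult(1)[OF yN] True filter_carrier by blast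
          moreover have "y \<otimes>\<^bsub>B\<^esub> x \<notin> I"
            using ideal_prime_B True yB Bm_B Bm_notin(3) by blast
          ultimately show ?thesis using True yB by (simp add: glue_B filter_carrier Bm_B minus_part_def)
        next
          case False
          then have "x \<in> Cm" using xC upper_iff by blast
          then show ?thesis using yN yB by (simp add: glue_mult_mixed sigma_Bm)
        qed
        then have "gle (y \<otimes>\<^bsub>D\<^esub> x) z \<longleftrightarrow> z \<notin> I" using gle_Bm_C zC by blast
        also have "\<dots> \<longleftrightarrow> rdiv C z x \<notin> I"
        proof (cases "z \<in> I")
          case True
          then have "x \<in> Cm" using not_B xC upper_iff ideal_carrier filter_carrier by blast
          then show ?thesis using True div_Cm_ideal by simp
        next
          case False
          then show ?thesis using upper_up[OF C.le_rdiv[of x z]] xC zC rdiv by auto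
        qed
        also have "\<dots> \<longleftrightarrow> gle y (rdiv D z x)" using gle_Bm_C yB rdiv by simp
        finally show ?thesis .
      qed
    next
      case False
      then have zB: "z \<in> Bm" using z ideal_carrier filter_carrier Cm_C N_iff by (elim D_cases) auto
      then have xCm: "x \<in> Cm" using not_B xC upper_iff filter_carrier Bm_B by blast
      have zN: "z \<in> carrier B" "z \<notin> F" using zB Bm_B Bm_notin by auto
      note gamma = B.gamma_residual[OF lower zN]
      from y show ?thesis
      proof (cases rule: D_cases)
        case 1
        then show ?thesis
          using xCm zB zN gamma
          by (simp add: glue_mult_mixed glue_div_Cm_Bm gle_B B.sigma_carrier)
      next
        case 2
        then have "y \<otimes>\<^bsub>D\<^esub> x \<in> Cm" using xCm by (simp add: glue_C Cm_C Cm_mult)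
        then show ?thesis using 2 xCm zB zN gamma by (simp add: glue_div_Cm_Bm gle_Cm_B)
      next
        case 3
        then have "y \<otimes>\<^bsub>D\<^esub> x \<in> Cm"
          using xCm by (simp add: glue_C Cm_C filter_carrier Cm_mult_filter)
        then show ?thesis using 3 xCm zB zN gamma by (simp add: glue_div_Cm_Bm not_gle_N)
      qed
    qed
  qed
qed

lemma irl_glue_proper: "irl D"
proof (rule irl_of_order[where leq = gle])
  show "monoid D" by (rule monoid_glue)
  show "gle x \<one>\<^bsub>D\<^esub>" if "x \<in> carrier D" for x
    using that B.one_in_filter filter_carrier
    by (elim D_cases) (simp_all add: gle_levels gle_B B.one_top)
  show "gle (x \<otimes>\<^bsub>D\<^esub> y) z \<longleftrightarrow> gle x (rdiv D z y)"
    if "x \<in> carrier D" "y \<in> carrier D" "z \<in> carrier D" for x y z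
    using that glue_rdiv_residual by blast
  show "rdiv D x y \<in> carrier D" if "x \<in> carrier D" "y \<in> carrier D" for x y
    using that glue_div_closed(2) by blast
qed (fact glue_meet_closed glue_join_closed glue_div_closed(1) gle_refl gle_antisym gle_trans
    gle_meet_iff gle_join_iff glue_ldiv_residual)+

end

section \<open>The glued algebra as a gluing\<close>

context compatible
begin

lemma irl_glue: "irl D"
proof (cases "Bm = {} \<or> Cm = {}")
  case True
  then show ?thesis using irl_glue_of_Bm_empty irl_glue_of_Cm_empty by blast
next
  case False
  then interpret compatible_proper B F C I by unfold_locales auto
  show ?thesis by (rule irl_glue_proper)
qed

sublocale D: irl D
  by (rule irl_glue)

text \<open>Joins of \<open>C\<close> are inherited directly, whereas meets pass through the
  exceptional branch of \<open>rmeet\<close>; the order is therefore read off joins.\<close>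

lemma rle_glue_C: "\<lbrakk>x \<in> carrier C; y \<in> carrier C\<rbrakk> \<Longrightarrow> rle D x y \<longleftrightarrow> rle C x y"
  by (simp add: D.le_iff_join C.le_iff_join glue_C)

lemma minus_notin_other:
  "b \<in> Bm \<Longrightarrow> b \<in> carrier B \<and> b \<notin> carrier C" "c \<in> Cm \<Longrightarrow> c \<in> carrier C \<and> c \<notin> carrier B"
  using inter by (auto simp: minus_part_def)

lemma rless_glue_mixed:
  assumes "b \<in> Bm" "c \<in> Cm"
  shows "rless D b c"
  using minus_notin_other(1)[OF assms(1)] minus_notin_other(2)[OF assms(2)] assms
  by (auto simp: rless_def rle_def glue_def)

text \<open>The hypothesis on \<open>C\<close> provides the conjugates by elements of
  \<open>C\<close>, which the glued algebra computes in \<open>C\<close>; those by elements of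
  \<open>B\<close> come from weak lower compatibility.\<close>

lemma is_gluing_glue:
  assumes "congruence_filter C F"
  shows "is_gluing B F C I D"
proof -
  interpret CF: irl_filter C F by unfold_locales fact
  have "congruence_filter D F"
    unfolding congruence_filter_def
  proof (intro conjI ballI impI)
    show "F \<subseteq> carrier D" "F \<noteq> {}" using filter_carrier B.one_in_filter by auto
    fix x assume x: "x \<in> F"
    note xBC = filter_carrier[OF x]
    show "x \<otimes>\<^bsub>D\<^esub> y \<in> F" if "y \<in> F" for y
      using that x xBC filter_carrier by (simp add: glue_B B.filter_mult)
    fix y assume y: "y \<in> carrier D"
    show "y \<in> F" if "rle D x y"
      using that y xBC B.filter_up[OF x, of y] filter_up_C[OF x, of y]
      by (auto simp: glue_B(5) rle_glue_C)
    show "rdiv D (y \<otimes>\<^bsub>D\<^esub> x) y \<in> F"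
      using y x xBC by (auto simp: glue_B glue_C B.filter_rconj CF.filter_rconj)
    show "ldiv D y (x \<otimes>\<^bsub>D\<^esub> y) \<in> F"
      using y x xBC by (auto simp: glue_B glue_C B.filter_lconj CF.filter_lconj)
  qed
  moreover have "lattice_ideal D I"
    unfolding lattice_ideal_def
  proof (intro conjI ballI impI)
    show "I \<subseteq> carrier D" using ideal_carrier by auto
    fix x assume x: "x \<in> I"
    show "x \<curlyvee>\<^bsub>D\<^esub> y \<in> I" if y: "y \<in> I" for y
    proof -
      have "x \<curlyvee>\<^bsub>C\<^esub> y \<in> I" using ideal x y unfolding lattice_ideal_def by blast
      then show ?thesis using ideal_carrier(2)[OF x] ideal_carrier(2)[OF y] by (simp add: glue_C)
    qed
    show "y \<in> I" if "y \<in> carrier D" "rle D y x" for y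
      using that ideal_carrier[OF x] ideal_down_B[OF x, of y] ideal_down_C[OF x, of y]
      by (auto simp: glue_B(5) rle_glue_C)
  qed
  moreover have "strictly_below D I Bm" "strictly_below D Bm F"
    using ideal_below_B filter_above_B
    by (simp_all add: strictly_below_def rless_def glue_B(5) minus_part_def ideal_carrier
      filter_carrier)
  moreover have "strictly_below D I Cm" "strictly_below D Cm F"
    using ideal_below_C filter_above_C
    by (simp_all add: strictly_below_def rless_def rle_glue_C minus_part_def ideal_carrier
      filter_carrier)
  moreover have "strictly_below D Bm Cm"
    using rless_glue_mixed by (simp add: strictly_below_def)
  ultimately show ?thesis
    using irl_glue inter one_eq by (simp add: is_gluing_def glue_B glue_C)
qed

section \<open>Uniqueness of the gluing\<close>

lemma gluing_order_mult:
  assumes E: "is_gluing B F C I E" and "x \<in> carrier E" "y \<in> carrier E"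
  shows "rle D x y \<longleftrightarrow> rle E x y" and "x \<otimes>\<^bsub>D\<^esub> y = x \<otimes>\<^bsub>E\<^esub> y"
proof -
  interpret E: irl E using E by (simp add: is_gluing_def)
  have carrier: "carrier E = carrier B \<union> carrier C" using E by (simp add: is_gluing_def)
  have EB: "u \<otimes>\<^bsub>E\<^esub> v = u \<otimes>\<^bsub>B\<^esub> v" "ldiv E u v = ldiv B u v" "rdiv E u v = rdiv B u v"
    "rle E u v \<longleftrightarrow> rle B u v" if "u \<in> carrier B" "v \<in> carrier B" for u v
    using E that by (auto simp: is_gluing_def rle_def)
  have EC: "u \<otimes>\<^bsub>E\<^esub> v = u \<otimes>\<^bsub>C\<^esub> v" "u \<curlyvee>\<^bsub>E\<^esub> v = u \<curlyvee>\<^bsub>C\<^esub> v"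
    if "u \<in> carrier C" "v \<in> carrier C" for u v
    using E that by (auto simp: is_gluing_def)
  \<comment> \<open>A gluing is only guaranteed to have the joins of \<open>C\<close>, not its
    meets, so the order on \<open>C\<close> is recovered from joins.\<close>
  have rle_EC: "rle E u v \<longleftrightarrow> rle C u v" if "u \<in> carrier C" "v \<in> carrier C" for u v
    using that by (simp add: E.le_iff_join C.le_iff_join EC carrier)
  have below: "rle E u c" "\<not> rle E c u" if "u \<in> carrier B - F" "c \<in> Cm" for u c
  proof -
    have "u \<in> I \<or> u \<in> Bm" using that(1) by (auto simp: minus_part_def)
    then have less: "rless E u c" using E that(2) by (auto simp: is_gluing_def strictly_below_def)
    then show "rle E u c" by (simp add: rless_def)
    show "\<not> rle E c u"
      using less that minus_notin_other(2)[OF that(2)] E.le_antisym[of u c]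
      by (auto simp: rless_def carrier)
  qed
  have belowF: "rle E c f" if "c \<in> Cm" "f \<in> F" for c f
    using E that by (auto simp: is_gluing_def strictly_below_def rless_def)
  have prod: "b \<otimes>\<^bsub>E\<^esub> c = sigma B F b" "c \<otimes>\<^bsub>E\<^esub> b = sigma B F b"
    if b: "b \<in> Bm" and c: "c \<in> Cm" for b c
  proof -
    have bB: "b \<in> carrier B" "b \<notin> F" using b by (auto simp: minus_part_def)
    have cC: "c \<in> carrier C" using minus_notin_other(2)[OF c] by simp
    have bcE: "b \<in> carrier E" "c \<in> carrier E" using bB cC by (simp_all add: carrier)
    have sB: "sigma B F b \<in> carrier B" using bB by (rule B.sigma_carrier)
    then have sE: "sigma B F b \<in> carrier E" by (simp add: carrier)
    \<comment> \<open>All of \<open>Cm\<close> lies strictly above b, so nothing in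
      \<open>Cm\<close> can be below b. This puts the mixed products in \<open>B\<close>, where
      divisions are those of \<open>B\<close>.\<close>
    have lower_B: "p \<in> carrier B" if "p \<in> carrier E" "rle E p b" for p
    proof (rule ccontr)
      assume "p \<notin> carrier B"
      then have "p \<in> Cm" using that(1) filter_carrier ideal_carrier
        by (auto simp: carrier minus_part_def)
      then show False using below(2)[of b p] bB that(2) by simp
    qed
    have above_F: "w \<in> F" if "w \<in> carrier B" "rle E c w" for w
      using below(2)[of w c] c that by blast
    show "b \<otimes>\<^bsub>E\<^esub> c = sigma B F b"
    proof (rule E.le_antisym)
      have p: "b \<otimes>\<^bsub>E\<^esub> c \<in> carrier B" using lower_B bcE by (simp add: E.mult_le1)
      \<comment> \<open>Residuals in \<open>B\<close> above c lie in \<open>F\<close>, and the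
        criterion for \<open>sigma\<close> turns this into the lower bound. The residual of sigma(b)
        by b lies in \<open>F\<close>, hence above c, and gives the upper bound.\<close>
      have "rle E c (ldiv E b (b \<otimes>\<^bsub>E\<^esub> c))" using bcE by (simp add: E.le_refl flip: E.ldiv_residual)
      then have "ldiv B b (b \<otimes>\<^bsub>E\<^esub> c) \<in> F" using above_F bB p by (simp add: EB B.ldiv_closed)
      then show "rle E (sigma B F b) (b \<otimes>\<^bsub>E\<^esub> c)"
        using bB p sB by (simp add: EB B.sigma_le_iff_ldiv)
      have "ldiv B b (sigma B F b) \<in> F" using bB sB by (simp add: B.le_refl flip: B.sigma_le_iff_ldiv)
      then have "rle E c (ldiv E b (sigma B F b))" using belowF c bB sB by (simp add: EB)
      then show "rle E (b \<otimes>\<^bsub>E\<^esub> c) (sigma B F b)" using bcE sE by (simp add: E.ldiv_residual)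
    qed (use bcE sE in simp_all)
    show "c \<otimes>\<^bsub>E\<^esub> b = sigma B F b"
    proof (rule E.le_antisym)
      have p: "c \<otimes>\<^bsub>E\<^esub> b \<in> carrier B" using lower_B bcE by (simp add: E.mult_le2)
      have "rle E c (rdiv E (c \<otimes>\<^bsub>E\<^esub> b) b)" using bcE by (simp add: E.le_refl flip: E.rdiv_residual)
      then have "rdiv B (c \<otimes>\<^bsub>E\<^esub> b) b \<in> F" using above_F bB p by (simp add: EB B.rdiv_closed)
      then show "rle E (sigma B F b) (c \<otimes>\<^bsub>E\<^esub> b)"
        using bB p sB by (simp add: EB B.sigma_le_iff_rdiv)
      have "rdiv B (sigma B F b) b \<in> F" using bB sB by (simp add: B.le_refl flip: B.sigma_le_iff_rdiv)
      then have "rle E c (rdiv E (sigma B F b) b)" using belowF c bB sB by (simp add: EB)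
      then show "rle E (c \<otimes>\<^bsub>E\<^esub> b) (sigma B F b)" using bcE sE by (simp add: E.rdiv_residual)
    qed (use bcE sE in simp_all)
  qed
  consider "x \<in> carrier B" "y \<in> carrier B" | "x \<in> carrier C" "y \<in> carrier C"
    | "x \<in> Bm" "y \<in> Cm" | "x \<in> Cm" "y \<in> Bm"
    using assms(2,3) filter_carrier ideal_carrier by (auto simp: carrier minus_part_def)
  then have "(rle D x y \<longleftrightarrow> rle E x y) \<and> x \<otimes>\<^bsub>D\<^esub> y = x \<otimes>\<^bsub>E\<^esub> y"
  proof cases
    case 1
    then show ?thesis by (simp add: glue_B EB)
  next
    case 2
    then show ?thesis by (simp add: glue_C rle_glue_C EC rle_EC)
  next
    case 3
    have "x \<otimes>\<^bsub>D\<^esub> y = sigma B F x"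
      using 3 minus_notin_other(1)[OF 3(1)] minus_notin_other(2)[OF 3(2)] by (simp add: glue_def)
    then show ?thesis
      using prod(1)[OF 3] rless_glue_mixed[OF 3] below(1)[of x y] 3
      by (auto simp: rless_def minus_part_def)
  next
    case 4
    \<comment> \<open>With x outside \<open>Bm\<close> the product falls to the last branch of
      \<open>glue\<close>, which applies \<open>sigma\<close> to y.\<close>
    have "x \<notin> Bm" using minus_notin_other 4(1) by blast
    then have "x \<otimes>\<^bsub>D\<^esub> y = sigma B F y"
      using 4 minus_notin_other(2)[OF 4(1)] minus_notin_other(1)[OF 4(2)] by (simp add: glue_def)
    moreover have "\<not> rle D x y"
      using rless_glue_mixed[OF 4(2,1)] D.le_antisym[of x y] assms(2,3)
      by (auto simp: rless_def carrier)
    moreover have "\<not> rle E x y" using below(2)[of y x] 4 by (auto simp: minus_part_def)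
    ultimately show ?thesis using prod(2)[OF 4(2,1)] by simp
  qed
  then show "rle D x y \<longleftrightarrow> rle E x y" "x \<otimes>\<^bsub>D\<^esub> y = x \<otimes>\<^bsub>E\<^esub> y" by auto
qed

lemma gluing_unique:
  assumes E: "is_gluing B F C I E"
  shows "agree_on (carrier E) E D"
proof (rule irl_agree_of_order_mult)
  show "irl E" "carrier D = carrier E" using E by (simp_all add: is_gluing_def)
qed (use irl_glue gluing_order_mult[OF E] in auto)

end

text \<open>A compatible quadruple makes \<open>F\<close> closed under conjugates in
  \<open>B\<close>, while a gluing needs this in \<open>C\<close> as well; hence the condition in
  the second conjunct. The last conjunct renders the definite article in "the gluing"; agreement is
  asked on the carrier because values outside it are arbitrary.\<close>

theorem theorem3p10:
  fixes B C :: "'a res_lattice" and F I :: "'a set"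
  assumes "compatible_quadruple B F C I"
  shows "irl (glue B F C I) \<and>
    (congruence_filter C F \<longrightarrow> is_gluing B F C I (glue B F C I)) \<and>
    (\<forall>D. is_gluing B F C I D \<longrightarrow> agree_on (carrier D) D (glue B F C I))"
proof -
  interpret compatible B F C I by unfold_locales fact
  show ?thesis using irl_glue is_gluing_glue gluing_unique by blast
qed

end
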